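(* Consider the multi-agent system described in the context, and suppose that every $f_{ij}$ is locally strongly convex, admits a minimum, and (without loss of generality) satisfies $f_{ij} \ge 0$. Then every trajectory $y$ of the system converges to a point of $\mathbb{R}^n$ as $t \to \infty$.
   Context: System. There are $n$ agents and a connected undirected graph $G$ on $\{1,\dots,n\}$; $i\sim j$ means that $i$ and $j$ are neighbors in $G$. For every ordered pair $(i,j)$ with $i \sim j$ there is a function $f_{ij}:\mathbb{R}\to\mathbb{R}$, twice differentiable with locally Lipschitz second derivative, satisfying the symmetry condition $f_{ij}(z) = f_{ji}(-z)$, and a known bound $\bar p_{ij}\ge 0$. Agent $i$ has position $y_i(t)\in\mathbb{R}$, and $y=(y_1,\dots,y_n):[0,\infty)\to\mathbb{R}^n$ is absolutely continuous and satisfies, for almost every $t$, $$\dot y_i(t) = h_i(t,u_i(t)),$$ where $h_i$ is an arbitrary function that preserves the sign of $u_i$ but may vanish (so $h_i(t,u)\ge 0$ if $u>0$, $h_i(t,u)\le 0$ if $u<0$, and $h_i(t,0)=0$). The agents' measurements are $$\hat\Delta_{ij}(t) = y_j(t)-y_i(t)+p_{ij}(t) \quad (j\sim i),$$ for arbitrary perturbations $p_{ij}(t)$ with $|p_{ij}(t)|\le \bar p_{ij}$. With $$g_i^+(t) = \sum_{j \sim i} \sup_{p \in [-\bar{p}_{ij}, \bar{p}_{ij}]} -f'_{ij}(\hat{\Delta}_{ij}(t) + p),\qquad g_i^-(t) = \sum_{j \sim i} \inf_{p \in [-\bar{p}_{ij}, \bar{p}_{ij}]} -f'_{ij}(\hat{\Delta}_{ij}(t)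 + p),$$ the control inputs are $$u_i(t) = -\max(g_i^-(t), 0) - \min(g_i^+(t), 0).$$ A trajectory of the system is any such $y$. A function $f:\mathbb{R}\to\mathbb{R}$ is locally strongly convex if on every bounded interval it is strongly convex with some positive modulus; for the functions considered here this means $f''>0$ everywhere. *)

theory Defs
  imports "HOL-Analysis.Analysis"
begin

definition strongly_convex_on :: "real \<Rightarrow> real set \<Rightarrow> (real \<Rightarrow> real) \<Rightarrow> bool" where
  "strongly_convex_on m S f \<longleftrightarrow>
     (\<forall>x\<in>S. \<forall>y\<in>S. \<forall>s\<in>{0..1}.
        f ((1 - s) * x + s * y)
          \<le> (1 - s) * f x + s * f y - m / 2 * s * (1 - s) * (x - y)\<^sup>2)"

definition locally_strongly_convex :: "(real \<Rightarrow> real) \<Rightarrow> bool" where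
  "locally_strongly_convex f \<longleftrightarrow> (\<forall>a b. \<exists>m>0. strongly_convex_on m {a..b} f)"

(* The dummy real argument only fits f'' to the library's time-dependent local_lipschitz. *)
definition twice_differentiable_lipschitz :: "(real \<Rightarrow> real) \<Rightarrow> bool" where
  "twice_differentiable_lipschitz f \<longleftrightarrow>
     (\<forall>x. f differentiable at x) \<and>
     (\<forall>x. deriv f differentiable at x) \<and>
     local_lipschitz UNIV UNIV (\<lambda>_::real. deriv (deriv f))"

(* Epsilon-delta absolute continuity. The finite families of non-overlapping closed
   subintervals are the sets d with d division_of \<Union>d. *)
definition absolutely_continuous_on :: "real set \<Rightarrow> (real \<Rightarrow> 'a::metric_space) \<Rightarrow> bool" where
  "absolutely_continuous_on S g \<longleftrightarrow>
     (\<forall>\<epsilon>>0. \<exists>\<delta>>0. \<forall>d. d division_of \<Union>d \<and> \<Union>d \<subseteq> S \<and> (\<Sum>K\<in>d. Sup K - Inf K) < \<delta> \<longrightarrow>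
        (\<Sum>K\<in>d. dist (g (Sup K)) (g (Inf K))) < \<epsilon>)"

locale multi_agent_system =
  fixes E :: "'n::finite \<Rightarrow> 'n \<Rightarrow> bool"
    and f :: "'n \<Rightarrow> 'n \<Rightarrow> real \<Rightarrow> real"
    and pbar :: "'n \<Rightarrow> 'n \<Rightarrow> real"
  assumes irreflexive: "irreflp E"
    and symmetric: "symp E"
    and connected: "E\<^sup>*\<^sup>* i j"
    and f_regular: "E i j \<Longrightarrow> twice_differentiable_lipschitz (f i j)"
    and f_symmetric: "E i j \<Longrightarrow> f i j z = f j i (- z)"
    and pbar_nonneg: "E i j \<Longrightarrow> 0 \<le> pbar i j"

definition measurement ::
  "('n \<Rightarrow> 'n \<Rightarrow> real \<Rightarrow> real) \<Rightarrow> (real \<Rightarrow> real ^ 'n) \<Rightarrow> 'n::finite \<Rightarrow> 'n \<Rightarrow> real \<Rightarrow> real" where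
  "measurement p y i j t = y t $ j - y t $ i + p i j t"

(* In the next three definitions, D i j t is the measured value. The suprema and infima
   are over compact intervals; f i j is continuously differentiable, so the sets are bounded. *)
definition g_plus ::
  "('n::finite \<Rightarrow> 'n \<Rightarrow> bool) \<Rightarrow> ('n \<Rightarrow> 'n \<Rightarrow> real \<Rightarrow> real) \<Rightarrow> ('n \<Rightarrow> 'n \<Rightarrow> real) \<Rightarrow>
   ('n \<Rightarrow> 'n \<Rightarrow> real \<Rightarrow> real) \<Rightarrow> 'n \<Rightarrow> real \<Rightarrow> real" where
  "g_plus E f pbar D i t =
     (\<Sum>j | E i j. SUP q\<in>{- pbar i j..pbar i j}. - deriv (f i j) (D i j t + q))"

definition g_minus ::
  "('n::finite \<Rightarrow> 'n \<Rightarrow> bool) \<Rightarrow> ('n \<Rightarrow> 'n \<Rightarrow> real \<Rightarrow> real) \<Rightarrow> ('n \<Rightarrow> 'n \<Rightarrow> real) \<Rightarrow>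
   ('n \<Rightarrow> 'n \<Rightarrow> real \<Rightarrow> real) \<Rightarrow> 'n \<Rightarrow> real \<Rightarrow> real" where
  "g_minus E f pbar D i t =
     (\<Sum>j | E i j. INF q\<in>{- pbar i j..pbar i j}. - deriv (f i j) (D i j t + q))"

definition control_input ::
  "('n::finite \<Rightarrow> 'n \<Rightarrow> bool) \<Rightarrow> ('n \<Rightarrow> 'n \<Rightarrow> real \<Rightarrow> real) \<Rightarrow> ('n \<Rightarrow> 'n \<Rightarrow> real) \<Rightarrow>
   ('n \<Rightarrow> 'n \<Rightarrow> real \<Rightarrow> real) \<Rightarrow> 'n \<Rightarrow> real \<Rightarrow> real" where
  "control_input E f pbar D i t =
     - max (g_minus E f pbar D i t) 0 - min (g_plus E f pbar D i t) 0"

definition sign_preserving :: "(real \<Rightarrow> real \<Rightarrow> real) \<Rightarrow> bool" where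
  "sign_preserving h \<longleftrightarrow>
     (\<forall>t\<ge>0. (\<forall>u>0. 0 \<le> h t u) \<and> (\<forall>u<0. h t u \<le> 0) \<and> h t 0 = 0)"

(* Only the restriction of y to [0,\<infinity>) matters. Absolute continuity on the unbounded time
   domain is understood on every compact interval [0,T], as usual for Caratheodory solutions. *)
definition trajectory ::
  "('n::finite \<Rightarrow> 'n \<Rightarrow> bool) \<Rightarrow> ('n \<Rightarrow> 'n \<Rightarrow> real \<Rightarrow> real) \<Rightarrow> ('n \<Rightarrow> 'n \<Rightarrow> real) \<Rightarrow>
   (real \<Rightarrow> real ^ 'n) \<Rightarrow> bool" where
  "trajectory E f pbar y \<longleftrightarrow>
     (\<forall>T\<ge>0. absolutely_continuous_on {0..T} y) \<and>
     (\<exists>h p. (\<forall>i. sign_preserving (h i)) \<and>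
            (\<forall>i j. E i j \<longrightarrow> (\<forall>t\<ge>0. \<bar>p i j t\<bar> \<le> pbar i j)) \<and>
            (AE t in lebesgue. 0 \<le> t \<longrightarrow>
               (y has_vector_derivative
                  (\<chi> i. h i t (control_input E f pbar (measurement p y) i t)))
               (at t within {0..})))"

end

theory Submission
  imports Defs
begin

text \<open>
  The energy \<open>V(y) = \<Sum> f\<^sub>i\<^sub>j (y\<^sub>j - y\<^sub>i)\<close> has, up to a factor, the gradient
  \<open>g\<^sub>i = - \<Sum> f\<^sub>i\<^sub>j' (y\<^sub>j - y\<^sub>i)\<close>, and each agent moves only against the sign of its own
  component \<open>g\<^sub>i\<close>. Two quantities therefore decrease: \<open>V\<close>, at rate \<open>\<Sum> \<bar>g\<^sub>i\<bar> \<bar>y\<^sub>i'\<bar>\<close>, and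
  \<open>\<Sum> \<bar>g\<^sub>i\<bar>\<close>, because the Hessian is a weighted graph Laplacian. While \<open>g\<^sub>j \<ge> \<epsilon>\<close>, a decrease of
  \<open>g\<^sub>j\<close> is caused either by agent \<open>j\<close> itself, which costs energy, or by neighbours with negative
  gradient, which costs \<open>l\<^sup>1\<close> norm. So \<open>K V + \<Sum> \<bar>g\<^sub>i\<bar> - g\<^sub>j\<close> is nonincreasing, and if \<open>g\<^sub>j\<close> does not tend
  to zero, then \<open>\<bar>g\<^sub>j\<bar>\<close> eventually stays away from zero and \<open>y\<^sub>j\<close> converges, having finite length.
  At two cluster points the gradients of the remaining agents vanish, so by strict convexity the
  points differ by a translation. Some converging \<open>y\<^sub>j\<close> excludes a translation; if there is none,
  then the cluster points are stationary and the largest deviation from a stationary point is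
  nonincreasing, which excludes it as well.
\<close>

subsection \<open>Monotonicity from almost everywhere slope bounds\<close>

text \<open>The bound is against the displacement of \<open>y\<close>, not against time. An
  observable of the state inherits absolute continuity in this way, although the curve itself need
  not be Lipschitz.\<close>

definition lipschitz_along :: "(real \<Rightarrow> 'a::metric_space) \<Rightarrow> real set \<Rightarrow> (real \<Rightarrow> real) \<Rightarrow> bool" where
  "lipschitz_along y S \<phi> \<longleftrightarrow> (\<exists>L\<ge>0. \<forall>u\<in>S. \<forall>v\<in>S. \<bar>\<phi> v - \<phi> u\<bar> \<le> L * dist (y v) (y u))"

text \<open>An upper derivative over intervals containing \<open>t\<close>, because \<open>\<bar>\<phi>\<bar>\<close> need not be
  differentiable where \<open>\<phi>\<close> vanishes.\<close>

definition straddle_slope_le :: "(real \<Rightarrow> real) \<Rightarrow> real \<Rightarrow> real \<Rightarrow> bool" where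
  "straddle_slope_le \<phi> t D \<longleftrightarrow>
     (\<forall>e>0. \<exists>d>0. \<forall>u v. t - d < u \<and> u \<le> t \<and> t \<le> v \<and> v < t + d \<longrightarrow> \<phi> v - \<phi> u \<le> (D + e) * (v - u))"

text \<open>Two distinct pieces meet in a convex set with empty interior, hence in a null set, so
  the measure is additive over the division.\<close>

lemma sum_content_division:
  fixes d :: "real set set"
  assumes d: "d division_of S"
  shows "(\<Sum>K\<in>d. measure lborel K) = measure lebesgue S"
proof -
  note D = division_ofD[OF d]
  have "measure lebesgue (\<Union>d) = sum (measure lebesgue) d"
  proof (rule measure_negligible_finite_Union)
    show "finite d" by (rule D(1))
    show "S \<in> lmeasurable" if "S \<in> d" for S using D(4)[OF that] by auto
    show "pairwise (\<lambda>S T. negligible (S \<inter> T)) d"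
    proof (rule pairwiseI)
      fix K L assume KL: "K \<in> d" "L \<in> d" "K \<noteq> L"
      have "convex (K \<inter> L)"
        using D(4)[OF KL(1)] D(4)[OF KL(2)] by (auto intro!: convex_Int)
      moreover have "interior (K \<inter> L) = {}" using D(5)[OF KL] by simp
      ultimately show "negligible (K \<inter> L)" by (simp add: negligible_convex_interior)
    qed
  qed
  moreover have "sum (measure lebesgue) d = (\<Sum>K\<in>d. measure lborel K)"
  proof (rule sum.cong[OF refl])
    fix K assume "K \<in> d"
    then show "measure lebesgue K = measure lborel K" using D(4) by fastforce
  qed
  ultimately show ?thesis by (simp add: D(6))
qed

text \<open>Two tags can share an interval only if it is degenerate. Its endpoints then coincide and
  its term is zero, so the tags may be forgotten.\<close>

lemma sum_tags_eq_sum_division: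
  fixes \<phi> :: "real \<Rightarrow> 'a::metric_space"
  assumes p: "p tagged_partial_division_of S"
  shows "(\<Sum>(x,K)\<in>p. dist (\<phi> (Sup K)) (\<phi> (Inf K))) = (\<Sum>K\<in>snd ` p. dist (\<phi> (Sup K)) (\<phi> (Inf K)))"
proof -
  \<comment> \<open>Terms must vanish on empty boxes too, where \<open>Sup\<close> and
    \<open>Inf\<close> carry no information; hence the explicit default 0.\<close>
  define h where "h K = (if K = {} then 0 else dist (\<phi> (Sup K)) (\<phi> (Inf K)))" for K :: "real set"
  note P = tagged_partial_division_ofD[OF p]
  have ne: "K \<noteq> {}" if "(x, K) \<in> p" for x K using P(2)[OF that] by auto
  have "(\<Sum>(x,K)\<in>p. h K) = sum h (snd ` p)"
  proof (rule sum.over_tagged_division_lemma[OF tagged_partial_division_of_Union_self[OF p]])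
    fix u v :: real assume "box u v = {}"
    then have "cbox u v = {} \<or> u = v" by (auto simp: box_real greaterThanLessThan_empty_iff)
    then show "h (cbox u v) = 0" by (auto simp: h_def)
  qed
  moreover have "(\<Sum>(x,K)\<in>p. h K) = (\<Sum>(x,K)\<in>p. dist (\<phi> (Sup K)) (\<phi> (Inf K)))"
    using ne by (intro sum.cong) (auto simp: h_def)
  moreover have "sum h (snd ` p) = (\<Sum>K\<in>snd ` p. dist (\<phi> (Sup K)) (\<phi> (Inf K)))"
    using ne by (intro sum.cong) (auto simp: h_def)
  ultimately show ?thesis by simp
qed

lemma sum_lengths_tagged:
  fixes a b :: real
  assumes "a \<le> b" "p tagged_division_of {a..b}"
  shows "(\<Sum>(x,K)\<in>p. Sup K - Inf K) = b - a"
  using additive_tagged_division_1[OF assms, of "\<lambda>x. x"] by simp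

text \<open>Cousin's lemma with a gauge that follows the slope bound off a null set and stays inside a
  small open cover on it; absolute continuity controls the intervals of the second kind.\<close>

lemma nonincreasing_if_slope_le_0:
  fixes y :: "real \<Rightarrow> 'a::metric_space" and \<phi> :: "real \<Rightarrow> real"
  assumes ab: "a \<le> b"
    and ac: "absolutely_continuous_on {a..b} y"
    and lip: "lipschitz_along y {a..b} \<phi>"
    and slope: "AE t in lebesgue. a < t \<and> t < b \<longrightarrow> straddle_slope_le \<phi> t 0"
  shows "\<phi> b \<le> \<phi> a"
proof -
  obtain L where L0: "L \<ge> 0" and L: "\<And>u v. u \<in> {a..b} \<Longrightarrow> v \<in> {a..b} \<Longrightarrow> \<bar>\<phi> v - \<phi> u\<bar> \<le> L * dist (y v) (y u)"
    using lip unfolding lipschitz_along_def by blast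
  obtain N0 where N0: "N0 \<in> null_sets lebesgue" and sl0: "\<And>t. t \<notin> N0 \<Longrightarrow> a < t \<and> t < b \<longrightarrow> straddle_slope_le \<phi> t 0"
    using AE_E3[OF slope] by auto
  \<comment> \<open>The endpoints join the null set, since the slope bound is given only strictly
    between them.\<close>
  define N where "N = N0 \<union> {a, b}"
  have "negligible N0" using N0 by (simp add: negligible_iff_null_sets)
  then have N: "negligible N" unfolding N_def by simp
  have sl: "straddle_slope_le \<phi> t 0" if "t \<notin> N" "t \<in> {a..b}" for t
    using sl0[of t] that by (auto simp: N_def)
  have "\<phi> b - \<phi> a \<le> \<epsilon>" if "\<epsilon> > 0" for \<epsilon>
  proof -
    \<comment> \<open>Each of the two kinds of intervals may contribute
      \<open>\<epsilon> / 2\<close>; the added 1 keeps both denominators positive.\<close>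
    define \<eta> where "\<eta> = \<epsilon> / (2 * (L + 1))"
    define e where "e = \<epsilon> / (2 * (b - a + 1))"
    have pos: "\<eta> > 0" "e > 0" using that L0 ab by (auto simp: \<eta>_def e_def)
    obtain \<delta> where d0: "\<delta> > 0" and \<delta>: "\<And>d. d division_of \<Union>d \<Longrightarrow> \<Union>d \<subseteq> {a..b} \<Longrightarrow> (\<Sum>K\<in>d. Sup K - Inf K) < \<delta>
        \<Longrightarrow> (\<Sum>K\<in>d. dist (y (Sup K)) (y (Inf K))) < \<eta>"
      using ac[unfolded absolutely_continuous_on_def, rule_format, OF pos(1)] by blast
    obtain U where U: "open U" "N \<subseteq> U" "U - N \<in> lmeasurable" "emeasure lebesgue (U - N) < ennreal \<delta>"
      using sets_lebesgue_outer_open[OF negligible_imp_sets[OF N] d0] by blast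
    have Um: "U \<in> lmeasurable" and UM: "measure lebesgue U < \<delta>"
    proof -
      have NN: "N \<in> null_sets lebesgue" using N by (simp add: negligible_iff_null_sets)
      have "U = (U - N) \<union> N" using U(2) by auto
      moreover have "emeasure lebesgue ((U - N) \<union> N) = emeasure lebesgue (U - N)"
        using U(3) NN by (intro emeasure_Un_null_set) auto
      ultimately have eq: "emeasure lebesgue U = emeasure lebesgue (U - N)" by simp
      show "U \<in> lmeasurable"
      proof (rule fmeasurableI)
        show "U \<in> sets lebesgue" using U(1) by (simp add: borel_open sets_completionI_sets)
        show "emeasure lebesgue U < \<infinity>"
          using U(4) unfolding eq by (metis ennreal_less_top infinity_ennreal_def order.strict_trans)
      qed
      then show "measure lebesgue U < \<delta>" using eq U(4) d0
        by (metis emeasure_eq_measure2 ennreal_less_iff measure_nonneg)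
    qed
    have "\<exists>r>0. ball t r \<subseteq> U" if "t \<in> N" for t
      using U(1,2) that by (meson openE subsetD)
    then obtain r where r: "\<And>t. t \<in> N \<Longrightarrow> r t > 0 \<and> ball t (r t) \<subseteq> U" by metis
    have "\<exists>d>0. \<forall>u v. t - d < u \<and> u \<le> t \<and> t \<le> v \<and> v < t + d \<longrightarrow> \<phi> v - \<phi> u \<le> (0 + e) * (v - u)"
      if "t \<notin> N" "t \<in> {a..b}" for t
      using sl[OF that] pos(2) unfolding straddle_slope_le_def by blast
    then obtain s where s: "\<And>t. t \<notin> N \<Longrightarrow> t \<in> {a..b} \<Longrightarrow> s t > 0 \<and> (\<forall>u v. t - s t < u \<and> u \<le> t \<and> t \<le> v \<and> v < t + s t \<longrightarrow> \<phi> v - \<phi> u \<le> e * (v - u))"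
      by (metis add_0)
    define \<gamma> where "\<gamma> t = (if t \<in> N then ball t (r t) else if t \<in> {a..b} then ball t (s t) else ball t 1)" for t
    have "gauge \<gamma>" using r s by (auto simp: gauge_def \<gamma>_def)
    then obtain p where p: "p tagged_division_of {a..b}" "\<gamma> fine p" by (rule fine_division_exists_real)
    note P = tagged_division_ofD[OF p(1)]
    have K: "x \<in> {a..b} \<and> Inf K \<le> x \<and> x \<le> Sup K \<and> Inf K \<in> K \<and> Sup K \<in> K \<and> K \<subseteq> {a..b} \<and> K \<subseteq> \<gamma> x"
      if xK: "(x, K) \<in> p" for x K
    proof -
      obtain c d where cd: "K = {c..d}" using P(4)[OF xK] by auto
      have "x \<in> K" using P(2)[OF xK] .
      with cd P(3)[OF xK] p(2) xK show ?thesis by (auto simp: fine_def)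
    qed
    \<comment> \<open>The intervals of \<open>q\<close> are tagged in the null set. They lie in
      \<open>U\<close>, so their total length is below \<open>\<delta>\<close> and absolute
      continuity bounds the sum of the displacements over them.\<close>
    define q where "q = {(x,K) \<in> p. x \<in> N}"
    have qp: "q \<subseteq> p" by (auto simp: q_def)
    have q: "q tagged_partial_division_of {a..b}"
      using p(1) qp unfolding tagged_division_of_def by (metis tagged_partial_division_subset)
    have dq: "snd ` q division_of \<Union>(snd ` q)"
      using q by (rule division_of_tagged_division[OF tagged_partial_division_of_Union_self])
    have "(\<Sum>K\<in>snd ` q. Sup K - Inf K) = (\<Sum>K\<in>snd ` q. measure lborel K)"
    proof (rule sum.cong[OF refl])
      fix K assume "K \<in> snd ` q"
      then obtain c d where "K = {c..d}" "K \<noteq> {}" using division_ofD(3,4)[OF dq] by (metis box_real(2))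
      then show "Sup K - Inf K = measure lborel K" by simp
    qed
    also have "\<dots> = measure lebesgue (\<Union>(snd ` q))" by (rule sum_content_division[OF dq])
    also have "\<dots> \<le> measure lebesgue U"
    proof (rule measure_mono_fmeasurable)
      show "\<Union>(snd ` q) \<subseteq> U" using K r by (fastforce simp: q_def \<gamma>_def)
      show "\<Union>(snd ` q) \<in> sets lebesgue" using lmeasurable_division[OF dq] by auto
    qed (rule Um)
    finally have "(\<Sum>K\<in>snd ` q. dist (y (Sup K)) (y (Inf K))) < \<eta>"
    proof (intro \<delta>[OF dq])
      show "\<Union>(snd ` q) \<subseteq> {a..b}" using K by (force simp: q_def)
    qed (use UM in simp)
    then have bad: "(\<Sum>(x,K)\<in>q. dist (y (Sup K)) (y (Inf K))) < \<eta>"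
      unfolding sum_tags_eq_sum_division[OF q] .
    have "\<phi> b - \<phi> a = (\<Sum>(x,K)\<in>p. \<phi> (Sup K) - \<phi> (Inf K))"
      using additive_tagged_division_1[OF ab p(1), of \<phi>] by simp
    also have "\<dots> = (\<Sum>(x,K)\<in>q. \<phi> (Sup K) - \<phi> (Inf K)) + (\<Sum>(x,K)\<in>p - q. \<phi> (Sup K) - \<phi> (Inf K))"
      using sum.subset_diff[OF qp P(1)] by (simp add: add.commute)
    also have "\<dots> \<le> (\<Sum>(x,K)\<in>q. L * dist (y (Sup K)) (y (Inf K))) + (\<Sum>(x,K)\<in>p - q. e * (Sup K - Inf K))"
    proof (intro add_mono sum_mono)
      fix z assume "z \<in> q"
      then obtain x K where z: "z = (x, K)" "(x,K) \<in> p" using qp by (cases z) auto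
      with K[of x K] L[of "Inf K" "Sup K"]
      show "(case z of (x,K) \<Rightarrow> \<phi> (Sup K) - \<phi> (Inf K)) \<le> (case z of (x,K) \<Rightarrow> L * dist (y (Sup K)) (y (Inf K)))"
        by (auto simp: subset_iff)
    next
      fix z assume "z \<in> p - q"
      then obtain x K where z: "z = (x, K)" "(x,K) \<in> p" "x \<notin> N" by (cases z) (auto simp: q_def)
      with K[of x K] have "K \<subseteq> ball x (s x)" "x \<in> {a..b}" by (auto simp: \<gamma>_def)
      with K[OF z(2)] have "\<bar>x - Inf K\<bar> < s x" "\<bar>x - Sup K\<bar> < s x" "Inf K \<le> x" "x \<le> Sup K"
        by (auto simp: subset_iff dist_real_def)
      with s[OF z(3) \<open>x \<in> {a..b}\<close>] have "\<phi> (Sup K) - \<phi> (Inf K) \<le> e * (Sup K - Inf K)"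
        by auto
      with z show "(case z of (x,K) \<Rightarrow> \<phi> (Sup K) - \<phi> (Inf K)) \<le> (case z of (x,K) \<Rightarrow> e * (Sup K - Inf K))"
        by auto
    qed
    also have "(\<Sum>(x,K)\<in>q. L * dist (y (Sup K)) (y (Inf K))) \<le> \<epsilon> / 2"
    proof -
      have "(\<Sum>(x,K)\<in>q. L * dist (y (Sup K)) (y (Inf K))) = L * (\<Sum>(x,K)\<in>q. dist (y (Sup K)) (y (Inf K)))"
        by (simp add: sum_distrib_left case_prod_unfold)
      also have "\<dots> \<le> L * \<eta>" using bad L0 by (intro mult_left_mono) auto
      also have "\<dots> \<le> (L + 1) * \<eta>" using pos by (simp add: algebra_simps)
      also have "\<dots> = \<epsilon> / 2" using L0 by (simp add: \<eta>_def field_simps)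
      finally show ?thesis .
    qed
    \<comment> \<open>The terms over \<open>q\<close> are nonnegative and are added back because all
      lengths together telescope to \<open>b - a\<close>.\<close>
    also have "(\<Sum>(x,K)\<in>p - q. e * (Sup K - Inf K)) \<le> (\<Sum>(x,K)\<in>p. e * (Sup K - Inf K))"
    proof (rule sum_mono2)
      show "0 \<le> (case z of (x,K) \<Rightarrow> e * (Sup K - Inf K))" if zp: "z \<in> p - (p - q)" for z
      proof -
        obtain x K where z: "z = (x, K)" "(x, K) \<in> p" using zp by (cases z) auto
        have "Inf K \<le> Sup K" using K[OF z(2)] by linarith
        with z pos(2) show ?thesis by simp
      qed
    qed (use P(1) in auto)
    also have "\<dots> = e * (b - a)"
      using sum_lengths_tagged[OF ab p(1)] by (simp add: sum_distrib_left[symmetric] case_prod_unfold)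
    also have "\<dots> \<le> \<epsilon> / 2"
    proof -
      have "e * (b - a) \<le> e * (b - a + 1)" using pos by simp
      also have "\<dots> = \<epsilon> / 2" using ab by (simp add: e_def field_simps)
      finally show ?thesis .
    qed
    finally show ?thesis by simp
  qed
  then have "\<phi> b - \<phi> a \<le> 0" by (rule field_le_epsilon[of _ 0, simplified]) 
  then show ?thesis by simp
qed

section \<open>Calculus of straddling slopes: sums, absolute values and maxima\<close>

lemma straddle_slope_le_mono:
  assumes "straddle_slope_le \<phi> t D" "D \<le> D'"
  shows "straddle_slope_le \<phi> t D'"
  unfolding straddle_slope_le_def
proof (intro allI impI)
  fix e :: real assume "e > 0"
  then obtain d where d: "d > 0" "\<And>u v. t - d < u \<and> u \<le> t \<and> t \<le> v \<and> v < t + d \<Longrightarrow> \<phi> v - \<phi> u \<le> (D + e) * (v - u)"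
    using assms(1) unfolding straddle_slope_le_def by blast
  have "\<phi> v - \<phi> u \<le> (D' + e) * (v - u)" if "t - d < u \<and> u \<le> t \<and> t \<le> v \<and> v < t + d" for u v
  proof -
    have "(D + e) * (v - u) \<le> (D' + e) * (v - u)" using assms(2) that by (intro mult_right_mono) auto
    with d(2)[OF that] show ?thesis by simp
  qed
  with d(1) show "\<exists>d>0. \<forall>u v. t - d < u \<and> u \<le> t \<and> t \<le> v \<and> v < t + d \<longrightarrow> \<phi> v - \<phi> u \<le> (D' + e) * (v - u)"
    by blast
qed

lemma straddle_slope_le_add:
  assumes "straddle_slope_le \<phi> t D" "straddle_slope_le \<psi> t D'"
  shows "straddle_slope_le (\<lambda>s. \<phi> s + \<psi> s) t (D + D')"
  unfolding straddle_slope_le_def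
proof (intro allI impI)
  fix e :: real assume "e > 0"
  then have e: "e / 2 > 0" by simp
  obtain d where d: "d > 0" "\<And>u v. t - d < u \<and> u \<le> t \<and> t \<le> v \<and> v < t + d \<Longrightarrow> \<phi> v - \<phi> u \<le> (D + e/2) * (v - u)"
    using assms(1) e unfolding straddle_slope_le_def by blast
  obtain d' where d': "d' > 0" "\<And>u v. t - d' < u \<and> u \<le> t \<and> t \<le> v \<and> v < t + d' \<Longrightarrow> \<psi> v - \<psi> u \<le> (D' + e/2) * (v - u)"
    using assms(2) e unfolding straddle_slope_le_def by blast
  have "\<phi> v + \<psi> v - (\<phi> u + \<psi> u) \<le> (D + D' + e) * (v - u)"
    if "t - min d d' < u \<and> u \<le> t \<and> t \<le> v \<and> v < t + min d d'" for u v
  proof -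
    have "\<phi> v - \<phi> u \<le> (D + e/2) * (v - u)" "\<psi> v - \<psi> u \<le> (D' + e/2) * (v - u)"
      using that by (auto intro!: d(2) d'(2))
    moreover have "(D + e/2) * (v - u) + (D' + e/2) * (v - u) = (D + D' + e) * (v - u)"
      by (simp add: field_simps)
    ultimately show ?thesis by linarith
  qed
  with d(1) d'(1) show "\<exists>d>0. \<forall>u v. t - d < u \<and> u \<le> t \<and> t \<le> v \<and> v < t + d \<longrightarrow>
      \<phi> v + \<psi> v - (\<phi> u + \<psi> u) \<le> (D + D' + e) * (v - u)"
    by (intro exI[of _ "min d d'"]) auto
qed

lemma straddle_slope_le_sum:
  assumes "\<And>i. i \<in> I \<Longrightarrow> straddle_slope_le (\<phi> i) t (D i)"
  shows "straddle_slope_le (\<lambda>s. \<Sum>i\<in>I. \<phi> i s) t (\<Sum>i\<in>I. D i)"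
  using assms
proof (induction I rule: infinite_finite_induct)
  case (insert i I)
  then show ?case using straddle_slope_le_add[of "\<phi> i" t "D i" "\<lambda>s. \<Sum>i\<in>I. \<phi> i s" "\<Sum>i\<in>I. D i"] by simp
qed (auto simp: straddle_slope_le_def intro!: exI[of _ 1])

text \<open>Subtract the first-order expansions at \<open>u\<close> and \<open>v\<close>. Since
  \<open>t\<close> lies between them, the errors \<open>e * (t - u)\<close> and
  \<open>e * (v - t)\<close> add up to exactly \<open>e * (v - u)\<close>.\<close>

lemma derivative_straddle_bound:
  fixes \<phi> :: "real \<Rightarrow> real"
  assumes "(\<phi> has_real_derivative D) (at t)" "e > 0"
  shows "\<exists>d>0. \<forall>u v. t - d < u \<and> u \<le> t \<and> t \<le> v \<and> v < t + d \<longrightarrow> \<bar>\<phi> v - \<phi> u - D * (v - u)\<bar> \<le> e * (v - u)"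
proof -
  obtain d where d: "d > 0" "\<And>w. \<bar>w - t\<bar> < d \<Longrightarrow> \<bar>\<phi> w - \<phi> t - D * (w - t)\<bar> \<le> e * \<bar>w - t\<bar>"
    using assms unfolding has_field_derivative_def has_derivative_at_alt by (auto simp: mult.commute)
  have "\<bar>\<phi> v - \<phi> u - D * (v - u)\<bar> \<le> e * (v - u)" if "t - d < u \<and> u \<le> t \<and> t \<le> v \<and> v < t + d" for u v
    using d(2)[of u] d(2)[of v] that by (simp add: algebra_simps abs_le_iff)
  with d(1) show ?thesis by blast
qed

lemma straddle_slope_le_derivative:
  assumes "(\<phi> has_real_derivative D) (at t)"
  shows "straddle_slope_le \<phi> t D"
  unfolding straddle_slope_le_def
proof (intro allI impI)
  fix e :: real assume "e > 0"
  from derivative_straddle_bound[OF assms this]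
  show "\<exists>d>0. \<forall>u v. t - d < u \<and> u \<le> t \<and> t \<le> v \<and> v < t + d \<longrightarrow> \<phi> v - \<phi> u \<le> (D + e) * (v - u)"
    by (fastforce simp: abs_le_iff algebra_simps)
qed

text \<open>Where \<open>\<phi>\<close> vanishes, the increment of its absolute value is at most the
  absolute increment of \<open>\<phi>\<close>, which gives the slope \<open>\<bar>D\<bar>\<close>;
  elsewhere the sign is locally constant. With both cases written as a sign times \<open>D\<close>,
  the slope of a sum of absolute values is a weighted sum of derivatives.\<close>

lemma straddle_slope_le_abs:
  assumes D: "(\<phi> has_real_derivative D) (at t)"
  shows "straddle_slope_le (\<lambda>s. \<bar>\<phi> s\<bar>) t ((if \<phi> t = 0 then sgn D else sgn (\<phi> t)) * D)"
proof (cases "\<phi> t = 0")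
  case True
  have "straddle_slope_le (\<lambda>s. \<bar>\<phi> s\<bar>) t \<bar>D\<bar>"
    unfolding straddle_slope_le_def
  proof (intro allI impI)
    fix e :: real assume "e > 0"
    from derivative_straddle_bound[OF D this] obtain d where d: "d > 0"
      "\<And>u v. t - d < u \<and> u \<le> t \<and> t \<le> v \<and> v < t + d \<Longrightarrow> \<bar>\<phi> v - \<phi> u - D * (v - u)\<bar> \<le> e * (v - u)" by blast
    have "\<bar>\<phi> v\<bar> - \<bar>\<phi> u\<bar> \<le> (\<bar>D\<bar> + e) * (v - u)" if uv: "t - d < u \<and> u \<le> t \<and> t \<le> v \<and> v < t + d" for u v
    proof -
      have "\<bar>D * (v - u)\<bar> = \<bar>D\<bar> * (v - u)" using uv by (simp add: abs_mult)
      then have "\<bar>\<phi> v\<bar> - \<bar>\<phi> u\<bar> \<le> \<bar>D\<bar> * (v - u) + e * (v - u)" using d(2)[OF uv] by linarith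
      then show ?thesis by (simp add: algebra_simps)
    qed
    with d(1) show "\<exists>d>0. \<forall>u v. t - d < u \<and> u \<le> t \<and> t \<le> v \<and> v < t + d \<longrightarrow> \<bar>\<phi> v\<bar> - \<bar>\<phi> u\<bar> \<le> (\<bar>D\<bar> + e) * (v - u)" by blast
  qed
  with True show ?thesis by (simp add: abs_sgn mult.commute)
next
  case False
  have "isCont (\<lambda>s. sgn (\<phi> t) * \<phi> s) t" by (rule DERIV_isCont[OF DERIV_cmult[OF D]])
  moreover have "sgn (\<phi> t) * \<phi> t > 0" using False by (simp add: sgn_if)
  ultimately have "\<forall>\<^sub>F s in nhds t. sgn (\<phi> t) * \<phi> s > 0"
    using order_tendstoD(1)[OF tendsto_at_iff_tendsto_nhds[THEN iffD1, OF isContD]] by blast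
  then have "\<forall>\<^sub>F s in nhds t. \<bar>\<phi> s\<bar> = sgn (\<phi> t) * \<phi> s"
    by eventually_elim (auto simp: sgn_if split: if_splits)
  then have "((\<lambda>s. \<bar>\<phi> s\<bar>) has_real_derivative sgn (\<phi> t) * D) (at t)"
    using DERIV_cmult[OF D, of "sgn (\<phi> t)"] by (subst DERIV_cong_ev[OF refl _ refl])
  then show ?thesis using straddle_slope_le_derivative False by (simp add: mult.commute)
qed

lemma Max_range_attained:
  fixes x :: "'n::finite \<Rightarrow> real"
  obtains k where "x k = Max (range x)"
proof -
  have "Max (range x) \<in> range x" by (rule Max_in) auto
  then show thesis by (metis imageE that)
qed

text \<open>Near \<open>t\<close> the maximum is attained only by indices that already attain it at
  \<open>t\<close>, so only their derivatives matter.\<close>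

lemma straddle_slope_le_Max:
  fixes x :: "'n::finite \<Rightarrow> real \<Rightarrow> real"
  assumes D: "\<And>i. (x i has_real_derivative D i) (at t)"
    and le: "\<And>i. x i t = Max (range (\<lambda>j. x j t)) \<Longrightarrow> D i \<le> D0"
  shows "straddle_slope_le (\<lambda>s. Max (range (\<lambda>i. x i s))) t D0"
  unfolding straddle_slope_le_def
proof (intro allI impI)
  fix e :: real assume e: "e > 0"
  define m where "m = Max (range (\<lambda>j. x j t))"
  obtain k0 where k0: "x k0 t = m"
    unfolding m_def by (rule Max_range_attained)
  \<comment> \<open>\<open>k0\<close> is a reference maximiser: an index not maximal at
    \<open>t\<close> stays strictly below it and cannot be the maximiser at
    \<open>v\<close>.\<close>
  have "\<exists>d>0. \<forall>u v. t - d < u \<and> u \<le> t \<and> t \<le> v \<and> v < t + d \<longrightarrow>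
     (x i t = m \<longrightarrow> x i v - x i u \<le> (D0 + e) * (v - u)) \<and> (x i t \<noteq> m \<longrightarrow> x i v < x k0 v)" for i
  proof (cases "x i t = m")
    case True
    then have "straddle_slope_le (x i) t D0"
      using straddle_slope_le_mono[OF straddle_slope_le_derivative[OF D] le] by (simp add: m_def)
    then show ?thesis using e True unfolding straddle_slope_le_def by auto
  next
    case False
    have "x i t \<le> m" unfolding m_def by (rule Max_ge) auto
    then have "x i t < x k0 t" using False k0 by simp
    moreover have "isCont (\<lambda>s. x k0 s - x i s) t" using D by (intro continuous_diff DERIV_isCont)
    ultimately have "\<forall>\<^sub>F s in at t. x k0 s - x i s > 0"
      unfolding isCont_def by (intro order_tendstoD(1)[where y = "x k0 t - x i t"]) auto
    then have "\<forall>\<^sub>F s in nhds t. x k0 s - x i s > 0"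
      using \<open>x i t < x k0 t\<close> by (auto simp: eventually_at_filter elim!: eventually_mono)
    then obtain d where "d > 0" "\<And>s. dist s t < d \<Longrightarrow> x k0 s - x i s > 0"
      unfolding eventually_nhds_metric by blast
    then show ?thesis using False by (intro exI[of _ d]) (auto simp: dist_real_def)
  qed
  then obtain d where d: "\<And>i. d i > 0" "\<And>i u v. t - d i < u \<and> u \<le> t \<and> t \<le> v \<and> v < t + d i \<Longrightarrow>
     (x i t = m \<longrightarrow> x i v - x i u \<le> (D0 + e) * (v - u)) \<and> (x i t \<noteq> m \<longrightarrow> x i v < x k0 v)" by metis
  define d0 where "d0 = Min (range d)"
  have d0: "d0 > 0" "\<And>i. d0 \<le> d i" using d(1) by (auto simp: d0_def)
  have "Max (range (\<lambda>i. x i v)) - Max (range (\<lambda>i. x i u)) \<le> (D0 + e) * (v - u)"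
    if uv: "t - d0 < u \<and> u \<le> t \<and> t \<le> v \<and> v < t + d0" for u v
  proof -
    \<comment> \<open>The index is chosen at the right end. At \<open>u\<close> its value bounds the
      maximum from below, which is the direction needed for an upper bound on the increment.\<close>
    obtain k where k: "x k v = Max (range (\<lambda>i. x i v))" by (rule Max_range_attained)
    have "t - d k < u \<and> u \<le> t \<and> t \<le> v \<and> v < t + d k" using uv d0(2)[of k] by auto
    note dk = d(2)[OF this]
    have "x k0 v \<le> x k v" unfolding k by (rule Max_ge) auto
    with dk have "x k v - x k u \<le> (D0 + e) * (v - u)" by auto
    moreover have "x k u \<le> Max (range (\<lambda>i. x i u))" by (rule Max_ge) auto
    ultimately show ?thesis using k by linarith
  qed
  with d0(1) show "\<exists>d>0. \<forall>u v. t - d < u \<and> u \<le> t \<and> t \<le> v \<and> v < t + d \<longrightarrow>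
      Max (range (\<lambda>i. x i v)) - Max (range (\<lambda>i. x i u)) \<le> (D0 + e) * (v - u)" by blast
qed

section \<open>Functions that are Lipschitz along a curve\<close>

lemma lipschitz_along_add:
  assumes "lipschitz_along y S \<phi>" "lipschitz_along y S \<psi>"
  shows "lipschitz_along y S (\<lambda>t. \<phi> t + \<psi> t)"
proof -
  obtain L M where "L \<ge> 0" "M \<ge> 0" and
    L: "\<And>u v. u\<in>S \<Longrightarrow> v\<in>S \<Longrightarrow> \<bar>\<phi> v - \<phi> u\<bar> \<le> L * dist (y v) (y u)" and
    M: "\<And>u v. u\<in>S \<Longrightarrow> v\<in>S \<Longrightarrow> \<bar>\<psi> v - \<psi> u\<bar> \<le> M * dist (y v) (y u)"
    using assms unfolding lipschitz_along_def by blast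
  have "\<bar>\<phi> v + \<psi> v - (\<phi> u + \<psi> u)\<bar> \<le> (L + M) * dist (y v) (y u)" if "u \<in> S" "v \<in> S" for u v
    using L[OF that] M[OF that] by (simp add: algebra_simps)
  with \<open>L \<ge> 0\<close> \<open>M \<ge> 0\<close> show ?thesis
    unfolding lipschitz_along_def by (intro exI[of _ "L + M"]) auto
qed

lemma lipschitz_along_sum:
  assumes "\<And>i. i \<in> I \<Longrightarrow> lipschitz_along y S (\<phi> i)"
  shows "lipschitz_along y S (\<lambda>t. \<Sum>i\<in>I. \<phi> i t)"
  using assms
proof (induction I rule: infinite_finite_induct)
  case (insert i I)
  then show ?case using lipschitz_along_add[of y S "\<phi> i" "\<lambda>t. \<Sum>i\<in>I. \<phi> i t"] by simp
qed (auto simp: lipschitz_along_def)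

lemma lipschitz_along_compose:
  assumes \<phi>: "lipschitz_along y S \<phi>" and h: "K-lipschitz_on (\<phi> ` S) h"
  shows "lipschitz_along y S (\<lambda>t. h (\<phi> t))"
proof -
  obtain L where "L \<ge> 0" and
    L: "\<And>u v. u\<in>S \<Longrightarrow> v\<in>S \<Longrightarrow> \<bar>\<phi> v - \<phi> u\<bar> \<le> L * dist (y v) (y u)"
    using assms unfolding lipschitz_along_def by blast
  have K: "K \<ge> 0" using h by (rule lipschitz_on_nonneg)
  have "\<bar>h (\<phi> v) - h (\<phi> u)\<bar> \<le> (K * L) * dist (y v) (y u)" if "u \<in> S" "v \<in> S" for u v
  proof -
    have "\<bar>h (\<phi> v) - h (\<phi> u)\<bar> \<le> K * \<bar>\<phi> v - \<phi> u\<bar>"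
      using lipschitz_onD[OF h, of "\<phi> v" "\<phi> u"] that by (auto simp: dist_real_def)
    also have "\<dots> \<le> K * (L * dist (y v) (y u))" using L[OF that] K by (rule mult_left_mono)
    finally show ?thesis by (simp add: mult.assoc)
  qed
  with \<open>L \<ge> 0\<close> K show ?thesis unfolding lipschitz_along_def by (intro exI[of _ "K * L"]) auto
qed

lemma lipschitz_along_cmult:
  assumes "lipschitz_along y S \<phi>"
  shows "lipschitz_along y S (\<lambda>t. c * \<phi> t)"
  by (rule lipschitz_along_compose[OF assms, where K = "\<bar>c\<bar>"])
    (auto simp: lipschitz_on_def dist_real_def abs_mult[symmetric] right_diff_distrib)

lemma lipschitz_along_uminus:
  assumes "lipschitz_along y S \<phi>"
  shows "lipschitz_along y S (\<lambda>t. - \<phi> t)"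
  using lipschitz_along_cmult[OF assms, of "-1"] by simp

lemma lipschitz_along_diff:
  assumes "lipschitz_along y S \<phi>" "lipschitz_along y S \<psi>"
  shows "lipschitz_along y S (\<lambda>t. \<phi> t - \<psi> t)"
  using lipschitz_along_add[OF assms(1) lipschitz_along_uminus[OF assms(2)]] by simp

lemma lipschitz_along_abs:
  assumes "lipschitz_along y S \<phi>"
  shows "lipschitz_along y S (\<lambda>t. \<bar>\<phi> t\<bar>)"
  by (rule lipschitz_along_compose[OF assms, where K = 1]) (auto simp: lipschitz_on_def dist_real_def)

lemma lipschitz_along_component:
  "lipschitz_along (y :: real \<Rightarrow> real ^ 'n::finite) S (\<lambda>t. y t $ i)"
  unfolding lipschitz_along_def
  by (intro exI[of _ 1]) (auto simp: dist_norm simp flip: vector_minus_component intro: component_le_norm_cart)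

lemma lipschitz_along_Max_diff:
  fixes y :: "real \<Rightarrow> real ^ 'n::finite"
  shows "lipschitz_along y S (\<lambda>t. Max (range (\<lambda>i. y t $ i - z $ i)))"
proof -
  have *: "Max (range (\<lambda>i. y v $ i - z $ i)) - Max (range (\<lambda>i. y u $ i - z $ i)) \<le> dist (y v) (y u)" for u v
  proof -
    obtain k where k: "y v $ k - z $ k = Max (range (\<lambda>i. y v $ i - z $ i))"
      by (rule Max_range_attained)
    have "y u $ k - z $ k \<le> Max (range (\<lambda>i. y u $ i - z $ i))" by (rule Max_ge) auto
    moreover have "y v $ k - y u $ k \<le> dist (y v) (y u)"
      using component_le_norm_cart[of "y v - y u" k] by (simp add: dist_norm)
    ultimately show ?thesis using k by linarith
  qed
  have "\<bar>Max (range (\<lambda>i. y v $ i - z $ i)) - Max (range (\<lambda>i. y u $ i - z $ i))\<bar> \<le> 1 * dist (y v) (y u)" for u v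
    using *[of u v] *[of v u] by (simp add: abs_le_iff dist_commute)
  then show ?thesis unfolding lipschitz_along_def by (intro exI[of _ 1]) auto
qed

lemma lipschitz_on_if_bounded_derivative:
  fixes h :: "real \<Rightarrow> real"
  assumes h: "\<And>z. (h has_real_derivative h' z) (at z)" and c: "continuous_on UNIV h'"
    and X: "bounded X"
  obtains K where "K-lipschitz_on X h"
proof -
  \<comment> \<open>\<open>X\<close> need not be convex, so the mean value bound is applied on a
    symmetric interval containing it.\<close>
  obtain r where r: "X \<subseteq> {-r..r}" using X
    by (metis bounded_subset_cbox_symmetric cbox_interval)
  have "bounded (h' ` {-r..r})"
    by (intro compact_imp_bounded compact_continuous_image continuous_on_subset[OF c]) auto
  then obtain K where K: "\<And>z. z \<in> {-r..r} \<Longrightarrow> \<bar>h' z\<bar> \<le> K"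
    by (auto simp: bounded_iff) (metis atLeastAtMost_iff)
  have "(max K 0)-lipschitz_on {-r..r} h"
  proof (rule lipschitz_onI)
    fix u v assume uv: "u \<in> {-r..r}" "v \<in> {-r..r}"
    have "norm (h u - h v) \<le> max K 0 * norm (u - v)"
    proof (rule field_differentiable_bound[of "{-r..r}" h h'])
      show "(h has_real_derivative h' z) (at z within {-r..r})" for z
        using h by (rule has_field_derivative_at_within)
      show "norm (h' z) \<le> max K 0" if "z \<in> {-r..r}" for z using K[OF that] by simp
    qed (use uv in auto)
    then show "dist (h u) (h v) \<le> max K 0 * dist u v" by (simp add: dist_norm)
  qed auto
  then show thesis using that lipschitz_on_subset r by blast
qed

lemma lipschitz_along_compose_C1:
  assumes \<phi>: "lipschitz_along y S \<phi>" and b: "bounded (\<phi> ` S)"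
    and h: "\<And>z. (h has_real_derivative h' z) (at z)" and c: "continuous_on UNIV h'"
  shows "lipschitz_along y S (\<lambda>t. h (\<phi> t))"
  using lipschitz_on_if_bounded_derivative[OF h c b] lipschitz_along_compose[OF \<phi>] by metis

section \<open>Absolute continuity and limits at infinity\<close>

lemma absolutely_continuous_on_subset:
  assumes "absolutely_continuous_on S g" "T \<subseteq> S"
  shows "absolutely_continuous_on T g"
  using assms unfolding absolutely_continuous_on_def by (meson order_trans)

lemma absolutely_continuous_on_imp_continuous_on:
  fixes g :: "real \<Rightarrow> 'a::metric_space"
  assumes "absolutely_continuous_on {a..b} g"
  shows "continuous_on {a..b} g"
  unfolding continuous_on_iff
proof (intro ballI allI impI)
  fix x e :: real assume x: "x \<in> {a..b}" and e: "0 < e"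
  obtain \<delta> where d0: "\<delta> > 0" and \<delta>: "\<And>d. d division_of \<Union>d \<Longrightarrow> \<Union>d \<subseteq> {a..b} \<Longrightarrow> (\<Sum>K\<in>d. Sup K - Inf K) < \<delta>
        \<Longrightarrow> (\<Sum>K\<in>d. dist (g (Sup K)) (g (Inf K))) < e"
    using assms[unfolded absolutely_continuous_on_def, rule_format, OF e] by blast
  have *: "dist (g v) (g u) < e" if "u \<in> {a..b}" "v \<in> {a..b}" "u \<le> v" "v - u < \<delta>" for u v
  proof -
    \<comment> \<open>A single interval is an admissible family, which turns absolute continuity
      into uniform continuity.\<close>
    have "{{u..v}} division_of \<Union>{{u..v}}" using division_of_self[of u v] that by simp
    from \<delta>[OF this] that show ?thesis by auto
  qed
  have "dist (g x') (g x) < e" if "x' \<in> {a..b}" "dist x' x < \<delta>" for x'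
    using *[of x x'] *[of x' x] x that by (cases "x \<le> x'") (auto simp: dist_real_def dist_commute)
  with d0 show "\<exists>d>0. \<forall>x'\<in>{a..b}. dist x' x < d \<longrightarrow> dist (g x') (g x) < e" by blast
qed

lemma nonincreasing_bounded_below_convergent:
  fixes \<phi> :: "real \<Rightarrow> real"
  assumes mono: "\<And>s t. a \<le> s \<Longrightarrow> s \<le> t \<Longrightarrow> \<phi> t \<le> \<phi> s" and bdd: "\<And>t. a \<le> t \<Longrightarrow> c \<le> \<phi> t"
  obtains l where "(\<phi> \<longlongrightarrow> l) at_top" "\<And>t. a \<le> t \<Longrightarrow> l \<le> \<phi> t"
proof
  let ?l = "Inf (\<phi> ` {a..})"
  have b: "bdd_below (\<phi> ` {a..})" using bdd by (auto intro!: bdd_belowI[of _ c])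
  show le: "?l \<le> \<phi> t" if "a \<le> t" for t using that b by (intro cInf_lower) auto
  show "(\<phi> \<longlongrightarrow> ?l) at_top"
  proof (rule order_tendstoI)
    fix z assume z: "z < ?l"
    show "\<forall>\<^sub>F t in at_top. z < \<phi> t"
      using eventually_ge_at_top[of a] by eventually_elim (use le z in force)
  next
    fix z assume "?l < z"
    then obtain s where s: "a \<le> s" "\<phi> s < z" using cInf_lessD[of "\<phi> ` {a..}" z] by auto
    show "\<forall>\<^sub>F t in at_top. \<phi> t < z"
      using eventually_ge_at_top[of s] by eventually_elim (use mono s in force)
  qed
qed

text \<open>Bounded values have a cluster point \<open>l\<close> at infinity. If \<open>l\<close>
  were not the limit, arbitrarily late times at distance at least \<open>e\<close> from
  \<open>l\<close> would produce a second cluster point.\<close>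

lemma tendsto_if_unique_cluster_point:
  fixes y :: "real \<Rightarrow> 'a::heine_borel"
  assumes b: "bounded (y ` {a..})"
    and unique: "\<And>S T l l'. \<lbrakk>filterlim S at_top sequentially; filterlim T at_top sequentially;
        (\<lambda>n. y (S n)) \<longlonglongrightarrow> l; (\<lambda>n. y (T n)) \<longlonglongrightarrow> l'\<rbrakk> \<Longrightarrow> l = l'"
  shows "\<exists>l. (y \<longlongrightarrow> l) at_top"
proof -
  have sub: "\<exists>l r. strict_mono (r :: nat \<Rightarrow> nat) \<and> filterlim (S \<circ> r) at_top sequentially \<and> (\<lambda>n. y ((S \<circ> r) n)) \<longlonglongrightarrow> l"
    if S: "\<And>n. S n \<ge> a" "filterlim S at_top sequentially" for S :: "nat \<Rightarrow> real"
  proof -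
    have "bounded (range (y \<circ> S))" using b by (rule bounded_subset) (use S(1) in auto)
    from bounded_imp_convergent_subsequence[OF this] obtain l r
      where r: "strict_mono (r :: nat \<Rightarrow> nat)" "((y \<circ> S) \<circ> r) \<longlonglongrightarrow> l" by blast
    have "filterlim (S \<circ> r) at_top sequentially"
      unfolding o_def by (rule filterlim_compose[OF S(2) filterlim_subseq[OF r(1)]])
    with r show ?thesis by (auto simp: o_def)
  qed
  have to_top: "filterlim (\<lambda>n. a + real n) at_top sequentially"
    by (rule filterlim_tendsto_add_at_top[OF tendsto_const filterlim_real_sequentially])
  obtain l and R :: "nat \<Rightarrow> real" where l: "filterlim R at_top sequentially" "(\<lambda>n. y (R n)) \<longlonglongrightarrow> l"
    using sub[OF _ to_top] by auto
  have "(y \<longlongrightarrow> l) at_top"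
  proof (rule ccontr)
    assume "\<not> (y \<longlongrightarrow> l) at_top"
    then obtain e where e: "e > 0" "\<not> (\<forall>\<^sub>F t in at_top. dist (y t) l < e)" by (auto simp: tendsto_iff)
    then have "\<exists>t\<ge>a + real n. \<not> dist (y t) l < e" for n
      by (auto simp: eventually_at_top_linorder)
    then obtain S where S: "\<And>n. S n \<ge> a + real n" "\<And>n. \<not> dist (y (S n)) l < e" by metis
    have "filterlim S at_top sequentially"
      by (rule filterlim_at_top_mono[OF to_top]) (use S in auto)
    moreover have "S n \<ge> a" for n using S(1)[of n] by linarith
    ultimately obtain l' r' where l': "filterlim (S \<circ> (r' :: nat \<Rightarrow> nat)) at_top sequentially" "(\<lambda>n. y ((S \<circ> r') n)) \<longlonglongrightarrow> l'"
      using sub[of S] by blast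
    have "l' = l" by (rule unique[OF l'(1) l(1) l'(2) l(2)])
    with l'(2) e(1) have "\<forall>\<^sub>F n in sequentially. dist (y ((S \<circ> r') n)) l < e" by (auto dest: tendstoD)
    with S(2) show False by (auto simp: eventually_sequentially)
  qed
  then show ?thesis by blast
qed

subsection \<open>Coordinatewise descent of a network energy\<close>

text \<open>The sum runs over ordered pairs, so for symmetric \<open>f\<close> every edge is counted
  twice. This is the source of the factor 2 in the energy rate.\<close>

definition edge_energy :: "('n::finite \<Rightarrow> 'n \<Rightarrow> real \<Rightarrow> real) \<Rightarrow> real ^ 'n \<Rightarrow> real" where
  "edge_energy f x = (\<Sum>i\<in>UNIV. \<Sum>j\<in>UNIV. f i j (x $ j - x $ i))"

text \<open>For symmetric \<open>f\<close> with derivatives \<open>F\<close> this is half the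
  partial derivative of \<open>edge_energy f\<close> in coordinate \<open>i\<close>.\<close>

definition edge_gradient :: "('n::finite \<Rightarrow> 'n \<Rightarrow> real \<Rightarrow> real) \<Rightarrow> real ^ 'n \<Rightarrow> 'n \<Rightarrow> real" where
  "edge_gradient F x i = (\<Sum>j\<in>UNIV. - F i j (x $ j - x $ i))"

text \<open>Pairs that are not edges carry zero functions here, so that all sums run over \<open>UNIV\<close>.\<close>

locale sign_descent =
  fixes E :: "'n::finite \<Rightarrow> 'n \<Rightarrow> bool"
    and f F A :: "'n \<Rightarrow> 'n \<Rightarrow> real \<Rightarrow> real"
    and y :: "real \<Rightarrow> real ^ 'n"
  assumes connected: "E\<^sup>*\<^sup>* i j"
    and E_sym: "E i j \<Longrightarrow> E j i"
    and f_deriv: "(f i j has_real_derivative F i j z) (at z)"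
    and F_deriv: "(F i j has_real_derivative A i j z) (at z)"
    and A_cont: "continuous_on UNIV (A i j)"
    and A_nonneg: "0 \<le> A i j z"
    and A_pos: "E i j \<Longrightarrow> 0 < A i j z"
    and f_sym: "f i j z = f j i (- z)"
    and f_nonneg: "0 \<le> f i j z"
    and f_coercive: "E i j \<Longrightarrow> \<exists>C. \<forall>z. f i j z \<le> c \<longrightarrow> \<bar>z\<bar> \<le> C"
    and y_ac: "0 \<le> T \<Longrightarrow> absolutely_continuous_on {0..T} y"
    and descent: "AE t in lebesgue. 0 < t \<longrightarrow> (\<exists>d. (y has_vector_derivative d) (at t) \<and>
      (\<forall>i. (0 < d $ i \<longrightarrow> edge_gradient F (y t) i < 0) \<and> (d $ i < 0 \<longrightarrow> 0 < edge_gradient F (y t) i)))"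
begin

abbreviation V :: "real \<Rightarrow> real" where "V t \<equiv> edge_energy f (y t)"
abbreviation G :: "'n \<Rightarrow> real \<Rightarrow> real" where "G i t \<equiv> edge_gradient F (y t) i"

text \<open>The pointwise content of \<open>descent\<close>, packaged so that slope estimates can be
  made at one time with one derivative \<open>d\<close>.\<close>

definition velocity :: "real \<Rightarrow> real ^ 'n \<Rightarrow> bool" where
  "velocity t d \<longleftrightarrow> (y has_vector_derivative d) (at t) \<and>
     (\<forall>i. (0 < d $ i \<longrightarrow> G i t < 0) \<and> (d $ i < 0 \<longrightarrow> 0 < G i t))"

section \<open>Symmetry, derivatives and regularity along the trajectory\<close>

lemma F_sym: "F i j z = - F j i (- z)"
proof -
  have "((\<lambda>z. f j i (- z)) has_real_derivative F j i (- z) * (- 1)) (at z)"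
    by (rule DERIV_chain2[OF f_deriv]) (auto intro!: derivative_eq_intros)
  moreover have "(\<lambda>z. f j i (- z)) = f i j" by (rule ext, rule f_sym[symmetric])
  ultimately show ?thesis using DERIV_unique[OF f_deriv] by fastforce
qed

lemma A_sym: "A i j z = A j i (- z)"
proof -
  have "((\<lambda>z. - F j i (- z)) has_real_derivative - (A j i (- z) * (- 1))) (at z)"
    by (rule DERIV_minus[OF DERIV_chain2[OF F_deriv]]) (auto intro!: derivative_eq_intros)
  moreover have "(\<lambda>z. - F j i (- z)) = F i j" by (rule ext, rule F_sym[symmetric])
  ultimately show ?thesis using DERIV_unique[OF F_deriv] by fastforce
qed

lemma F_continuous: "continuous_on UNIV (F i j)"
  using F_deriv by (meson DERIV_continuous continuous_at_imp_continuous_on)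

lemma F_strict_mono: "E i j \<Longrightarrow> u < v \<Longrightarrow> F i j u < F i j v"
  by (rule DERIV_pos_imp_increasing) (auto intro: F_deriv A_pos)

lemma F_mono: "u \<le> v \<Longrightarrow> F i j u \<le> F i j v"
  by (rule DERIV_nonneg_imp_nondecreasing) (auto intro: F_deriv A_nonneg)

text \<open>Summation by parts on the graph. It serves to differentiate the energy, with
  \<open>\<omega>\<close> the edge forces, and to compare two points, with \<open>\<omega>\<close>
  the differences of their forces.\<close>

lemma sum_antisymmetric:
  fixes \<omega> :: "'n \<Rightarrow> 'n \<Rightarrow> real"
  assumes "\<And>i j. \<omega> i j = - \<omega> j i"
  shows "(\<Sum>i\<in>UNIV. \<Sum>j\<in>UNIV. \<omega> i j * (c j - c i)) = 2 * (\<Sum>i\<in>UNIV. (\<Sum>j\<in>UNIV. - \<omega> i j) * c i)"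
proof -
  have "(\<Sum>i\<in>UNIV. \<Sum>j\<in>UNIV. \<omega> i j * c j) = (\<Sum>i\<in>UNIV. \<Sum>j\<in>UNIV. \<omega> j i * c i)"
    by (rule sum.swap)
  also have "\<dots> = (\<Sum>i\<in>UNIV. \<Sum>j\<in>UNIV. - \<omega> i j * c i)"
  proof (intro sum.cong refl)
    show "\<omega> j i * c i = - \<omega> i j * c i" for i j using assms[of j i] by simp
  qed
  finally show ?thesis
    by (simp add: right_diff_distrib sum_subtractf sum_distrib_right sum_negf)
qed

lemma component_derivative:
  assumes "velocity t d"
  shows "((\<lambda>s. y s $ i) has_real_derivative d $ i) (at t)"
  using assms bounded_linear.has_vector_derivative[OF bounded_linear_vec_nth, of y d "at t" i]
  by (simp add: velocity_def has_real_derivative_iff_has_vector_derivative)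

lemma V_derivative:
  assumes "velocity t d"
  shows "(V has_real_derivative 2 * (\<Sum>i\<in>UNIV. G i t * d $ i)) (at t)"
proof -
  have "(V has_real_derivative (\<Sum>i\<in>UNIV. \<Sum>j\<in>UNIV. F i j (y t $ j - y t $ i) * (d $ j - d $ i))) (at t)"
    unfolding edge_energy_def
    by (intro DERIV_sum DERIV_chain2[OF f_deriv] DERIV_diff component_derivative[OF assms])
  also have "(\<Sum>i\<in>UNIV. \<Sum>j\<in>UNIV. F i j (y t $ j - y t $ i) * (d $ j - d $ i)) = 2 * (\<Sum>i\<in>UNIV. G i t * d $ i)"
    unfolding edge_gradient_def by (rule sum_antisymmetric) (metis F_sym minus_diff_eq)
  finally show ?thesis .
qed

abbreviation a :: "real \<Rightarrow> 'n \<Rightarrow> 'n \<Rightarrow> real" where "a t i j \<equiv> A i j (y t $ j - y t $ i)"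

lemma a_sym: "a t i j = a t j i"
  by (metis A_sym minus_diff_eq)

lemma G_derivative:
  assumes "velocity t d"
  shows "(G i has_real_derivative (\<Sum>j\<in>UNIV. a t i j * (d $ i - d $ j))) (at t)"
proof -
  have "(G i has_real_derivative (\<Sum>j\<in>UNIV. - (a t i j * (d $ j - d $ i)))) (at t)"
    unfolding edge_gradient_def
    by (intro DERIV_sum DERIV_minus DERIV_chain2[OF F_deriv] DERIV_diff component_derivative[OF assms])
  then show ?thesis by (simp add: minus_mult_right del: mult_minus_right)
qed

lemma V_rate_nonpos: "velocity t d \<Longrightarrow> G i t * d $ i \<le> 0"
  unfolding velocity_def by (metis linorder_neqE_linordered_idom mult_neg_pos mult_pos_neg mult_zero_right order.order_iff_strict)

lemma y_continuous: "continuous_on {0..} y"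
proof -
  have "continuous (at t within {0..}) y" if "0 \<le> t" for t
  proof -
    have "continuous_on {0..t + 1} y"
      by (rule absolutely_continuous_on_imp_continuous_on[OF y_ac]) (use that in auto)
    then have "continuous (at t within {0..t + 1}) y"
      using that by (simp add: continuous_on_eq_continuous_within)
    moreover have "at t within {0..t + 1} = at t within {0..}"
      by (rule at_within_nhd[where S = "{..<t + 1}"]) auto
    ultimately show ?thesis by simp
  qed
  then show ?thesis by (simp add: continuous_on_eq_continuous_within)
qed

text \<open>On a compact time interval the differences stay bounded by continuity, so a continuously
  differentiable function is Lipschitz on the range that occurs.\<close>

lemma lipschitz_along_C1:
  assumes h: "\<And>z. (h has_real_derivative h' z) (at z)" "continuous_on UNIV h'" and s: "0 \<le> s"
  shows "lipschitz_along y {s..t} (\<lambda>r. h (y r $ j - y r $ i))"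
proof (rule lipschitz_along_compose_C1[OF _ _ h])
  show "lipschitz_along y {s..t} (\<lambda>r. y r $ j - y r $ i)"
    by (intro lipschitz_along_diff lipschitz_along_component)
  have "continuous_on {s..t} y" using y_continuous s by (auto intro: continuous_on_subset)
  then show "bounded ((\<lambda>r. y r $ j - y r $ i) ` {s..t})"
    by (intro compact_imp_bounded compact_continuous_image continuous_intros) auto
qed

lemma lipschitz_along_V: "0 \<le> s \<Longrightarrow> lipschitz_along y {s..t} V"
  unfolding edge_energy_def by (intro lipschitz_along_sum lipschitz_along_C1[OF f_deriv F_continuous])

lemma lipschitz_along_G: "0 \<le> s \<Longrightarrow> lipschitz_along y {s..t} (G i)"
  unfolding edge_gradient_def
  by (intro lipschitz_along_sum lipschitz_along_uminus lipschitz_along_C1[OF F_deriv A_cont])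

text \<open>Reduces each later monotonicity claim to a slope estimate at a single time where a
  velocity exists.\<close>

lemma nonincreasing:
  assumes st: "0 \<le> s" "s \<le> t" and lip: "lipschitz_along y {s..t} \<phi>"
    and slope: "\<And>r d. s < r \<Longrightarrow> r < t \<Longrightarrow> velocity r d \<Longrightarrow> straddle_slope_le \<phi> r 0"
  shows "\<phi> t \<le> \<phi> s"
proof (rule nonincreasing_if_slope_le_0[OF st(2) _ lip])
  show "absolutely_continuous_on {s..t} y"
    by (rule absolutely_continuous_on_subset[OF y_ac[of t]]) (use st in auto)
  show "AE r in lebesgue. s < r \<and> r < t \<longrightarrow> straddle_slope_le \<phi> r 0"
    using descent
  proof eventually_elim
    case (elim r)
    then show ?case using st(1) slope[of r] unfolding velocity_def by fastforce
  qed
qed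

section \<open>Energy decrease, a priori bounds and the slope of the gradient norm\<close>

lemma V_nonincreasing:
  assumes "0 \<le> s" "s \<le> t"
  shows "V t \<le> V s"
proof (rule nonincreasing[OF assms lipschitz_along_V[OF assms(1)]])
  fix r d assume d: "velocity r d"
  have "2 * (\<Sum>i\<in>UNIV. G i r * d $ i) \<le> 0"
    using V_rate_nonpos[OF d] by (simp add: sum_nonpos)
  then show "straddle_slope_le V r 0"
    by (rule straddle_slope_le_mono[OF straddle_slope_le_derivative[OF V_derivative[OF d]]])
qed

lemma V_nonneg: "0 \<le> V t"
  unfolding edge_energy_def by (intro sum_nonneg f_nonneg)

text \<open>All terms of the energy are nonnegative, so each is at most the initial energy.
  Coercivity then bounds the differences across edges, and connecting paths propagate the bound to
  all pairs.\<close>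

lemma differences_bounded:
  obtains C where "\<And>t i j. 0 \<le> t \<Longrightarrow> \<bar>y t $ j - y t $ i\<bar> \<le> C"
proof -
  have edge: "\<exists>C. \<forall>t\<ge>0. \<bar>y t $ j - y t $ i\<bar> \<le> C" if ij: "E i j" for i j
  proof -
    obtain C where C: "\<And>z. f i j z \<le> V 0 \<Longrightarrow> \<bar>z\<bar> \<le> C" using f_coercive[OF ij, of "V 0"] by blast
    have "f i j (y t $ j - y t $ i) \<le> V 0" if "0 \<le> t" for t
    proof -
      have "f i j (y t $ j - y t $ i) \<le> (\<Sum>j\<in>UNIV. f i j (y t $ j - y t $ i))"
        by (rule member_le_sum) (auto intro: f_nonneg)
      also have "\<dots> \<le> V t" unfolding edge_energy_def
        by (rule member_le_sum[where f = "\<lambda>i. \<Sum>j\<in>UNIV. f i j (y t $ j - y t $ i)"]) (auto intro!: sum_nonneg f_nonneg)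
      also have "\<dots> \<le> V 0" by (rule V_nonincreasing) (use that in auto)
      finally show ?thesis .
    qed
    with C show ?thesis by blast
  qed
  have "\<exists>C. \<forall>t\<ge>0. \<bar>y t $ j - y t $ i\<bar> \<le> C" for i j
    using connected[of i j]
  proof (induction rule: rtranclp_induct)
    case base show ?case by auto
  next
    case (step j k)
    then obtain C C' where "\<And>t. 0 \<le> t \<Longrightarrow> \<bar>y t $ j - y t $ i\<bar> \<le> C" "\<And>t. 0 \<le> t \<Longrightarrow> \<bar>y t $ k - y t $ j\<bar> \<le> C'"
      using edge by meson
    then have "\<bar>y t $ k - y t $ i\<bar> \<le> C + C'" if "0 \<le> t" for t
      using that by (smt (verit, best))
    then show ?case by blast
  qed
  then have "\<exists>C. \<forall>i j. \<forall>t\<ge>0. \<bar>y t $ j - y t $ i\<bar> \<le> C i j" by (intro choice allI)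
  then obtain C where C: "\<And>i j t. 0 \<le> t \<Longrightarrow> \<bar>y t $ j - y t $ i\<bar> \<le> C i j" by blast
  have "\<bar>y t $ j - y t $ i\<bar> \<le> Max (range (\<lambda>(i, j). C i j))" if "0 \<le> t" for t i j
  proof -
    have "C i j \<le> Max (range (\<lambda>(i, j). C i j))" by (rule Max_ge) (auto intro!: image_eqI[of _ _ "(i, j)"])
    with C[OF that, of j i] show ?thesis by linarith
  qed
  then show thesis by (rule that)
qed

text \<open>The differences stay in a compact interval, where the continuous functions
  \<open>A i j\<close> are bounded; as there are finitely many pairs, one constant works for all
  times and agents.\<close>

lemma stiffness_bounded:
  obtains B where "\<And>t i. 0 \<le> t \<Longrightarrow> (\<Sum>k\<in>UNIV. a t i k) \<le> B" "0 \<le> B"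
proof -
  obtain C where C: "\<And>t i j. 0 \<le> t \<Longrightarrow> \<bar>y t $ j - y t $ i\<bar> \<le> C" using differences_bounded by blast
  have "\<exists>b. \<forall>z\<in>{-C..C}. A i j z \<le> b" for i j
  proof -
    have "compact (A i j ` {-C..C})"
      by (intro compact_continuous_image continuous_on_subset[OF A_cont]) auto
    then have "bdd_above (A i j ` {-C..C})" by (intro bounded_imp_bdd_above compact_imp_bounded)
    then show ?thesis by (auto simp: bdd_above_def)
  qed
  then obtain b where b: "\<And>i j z. z \<in> {-C..C} \<Longrightarrow> A i j z \<le> b i j" by metis
  have b0: "0 \<le> b i j" for i j
  proof -
    have "0 \<le> C" using C[of 0] abs_ge_zero order_trans by blast
    then have "A i j 0 \<le> b i j" by (intro b) auto
    then show ?thesis using A_nonneg[of i j 0] by linarith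
  qed
  have "(\<Sum>k\<in>UNIV. a t i k) \<le> (\<Sum>i\<in>UNIV. \<Sum>k\<in>UNIV. b i k)" if "0 \<le> t" for t i
  proof -
    have "a t i k \<le> b i k" for k
      using C[OF that, of k i] by (intro b) (simp, linarith)
    then have "(\<Sum>k\<in>UNIV. a t i k) \<le> (\<Sum>k\<in>UNIV. b i k)" by (rule sum_mono)
    also have "\<dots> \<le> (\<Sum>i\<in>UNIV. \<Sum>k\<in>UNIV. b i k)"
      by (rule member_le_sum[where f = "\<lambda>i. \<Sum>k\<in>UNIV. b i k"]) (auto intro!: sum_nonneg b0)
    finally show ?thesis .
  qed
  then show thesis by (rule that) (auto intro!: sum_nonneg b0)
qed

text \<open>The Hessian is a weighted graph Laplacian, so gradient mass only moves along edges, and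
  masses of opposite sign cancel.\<close>

lemma gradient_norm_slope:
  assumes d: "velocity t d"
  obtains s where "\<And>i k. d $ i * (s i - s k) \<le> 0" "\<And>i. 0 < G i t \<Longrightarrow> s i = 1" "\<And>i. d $ i * s i \<le> 0"
    "straddle_slope_le (\<lambda>r. \<Sum>i\<in>UNIV. \<bar>G i r\<bar>) t (\<Sum>i\<in>UNIV. \<Sum>k\<in>UNIV. a t i k * (d $ i * (s i - s k)))"
proof
  define G' where "G' i = (\<Sum>k\<in>UNIV. a t i k * (d $ i - d $ k))" for i
  \<comment> \<open>\<open>s i\<close> is a slope of the absolute value at \<open>G i t\<close>. At
    a zero it takes the sign of the rate \<open>G' i\<close>, so that \<open>s i * G' i\<close> is
    the absolute value of this rate.\<close>
  define s where "s i = (if G i t = 0 then sgn (G' i) else sgn (G i t))" for i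
  have s1: "\<bar>s i\<bar> \<le> 1" for i by (auto simp: s_def sgn_if)
  \<comment> \<open>A moving agent has a nonzero gradient, so its sign \<open>s i\<close> is exactly
    opposite to its motion. As every \<open>s k\<close> lies between -1 and 1, this makes
    \<open>d $ i * (s i - s k)\<close> nonpositive.\<close>
  have cases: "d $ i = 0 \<or> (d $ i > 0 \<and> s i = - 1) \<or> (d $ i < 0 \<and> s i = 1)" for i
  proof -
    have "(0 < d $ i \<longrightarrow> G i t < 0) \<and> (d $ i < 0 \<longrightarrow> 0 < G i t)" using d unfolding velocity_def by blast
    then show ?thesis by (auto simp: s_def sgn_if)
  qed
  show "d $ i * (s i - s k) \<le> 0" for i k
    using cases[of i] s1[of k] by (auto simp: mult_le_0_iff abs_le_iff)
  show "d $ i * s i \<le> 0" for i using cases[of i] by auto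
  show "s i = 1" if "0 < G i t" for i using that by (simp add: s_def)
  have "straddle_slope_le (\<lambda>r. \<Sum>i\<in>UNIV. \<bar>G i r\<bar>) t (\<Sum>i\<in>UNIV. s i * G' i)"
    unfolding s_def G'_def
    by (intro straddle_slope_le_sum straddle_slope_le_abs[OF G_derivative[OF d]])
  \<comment> \<open>Exchanging the indices and using the symmetry of \<open>a\<close> collects all
    terms that contain the velocity of the same agent.\<close>
  also have "(\<Sum>i\<in>UNIV. s i * G' i) = (\<Sum>i\<in>UNIV. \<Sum>k\<in>UNIV. a t i k * (d $ i * (s i - s k)))"
  proof -
    have "(\<Sum>i\<in>UNIV. s i * G' i) =
        (\<Sum>i\<in>UNIV. \<Sum>k\<in>UNIV. a t i k * (d $ i * s i)) - (\<Sum>i\<in>UNIV. \<Sum>k\<in>UNIV. a t i k * (d $ k * s i))"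
      by (simp add: G'_def sum_distrib_left flip: sum_subtractf) (simp add: algebra_simps)
    also have "(\<Sum>i\<in>UNIV. \<Sum>k\<in>UNIV. a t i k * (d $ k * s i)) = (\<Sum>i\<in>UNIV. \<Sum>k\<in>UNIV. a t k i * (d $ i * s k))"
      by (rule sum.swap)
    also have "\<dots> = (\<Sum>i\<in>UNIV. \<Sum>k\<in>UNIV. a t i k * (d $ i * s k))"
      by (subst a_sym) (rule refl)
    finally show ?thesis by (simp add: algebra_simps flip: sum_subtractf)
  qed
  finally show "straddle_slope_le (\<lambda>r. \<Sum>i\<in>UNIV. \<bar>G i r\<bar>) t (\<Sum>i\<in>UNIV. \<Sum>k\<in>UNIV. a t i k * (d $ i * (s i - s k)))" .
qed

section \<open>Persistence of a large gradient and convergence of components\<close>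

text \<open>The Lyapunov function of the overview. The weight \<open>K\<close> stays free because it
  has to be at least the stiffness bound divided by twice the gradient threshold.\<close>

definition W :: "real \<Rightarrow> real \<Rightarrow> real" where
  "W K t = K * V t + (\<Sum>i\<in>UNIV. \<bar>G i t\<bar>)"

lemma lipschitz_along_W: "0 \<le> s \<Longrightarrow> lipschitz_along y {s..t} (W K)"
  unfolding W_def
  by (intro lipschitz_along_add lipschitz_along_cmult lipschitz_along_V lipschitz_along_sum
      lipschitz_along_abs lipschitz_along_G)

lemma W_nonincreasing:
  assumes K: "0 \<le> K" and st: "0 \<le> s" "s \<le> t"
  shows "W K t \<le> W K s"
proof (rule nonincreasing[OF st lipschitz_along_W[OF st(1)]])
  fix r d assume d: "velocity r d"
  obtain \<sigma> where \<sigma>: "\<And>i k. d $ i * (\<sigma> i - \<sigma> k) \<le> 0" "\<And>i. 0 < G i r \<Longrightarrow> \<sigma> i = 1" "\<And>i. d $ i * \<sigma> i \<le> 0"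
    "straddle_slope_le (\<lambda>r. \<Sum>i\<in>UNIV. \<bar>G i r\<bar>) r (\<Sum>i\<in>UNIV. \<Sum>k\<in>UNIV. a r i k * (d $ i * (\<sigma> i - \<sigma> k)))"
    using gradient_norm_slope[OF d] by blast
  have "(\<Sum>i\<in>UNIV. G i r * d $ i) \<le> 0" using V_rate_nonpos[OF d] by (intro sum_nonpos) auto
  moreover have "(\<Sum>i\<in>UNIV. \<Sum>k\<in>UNIV. a r i k * (d $ i * (\<sigma> i - \<sigma> k))) \<le> 0"
    by (intro sum_nonpos mult_nonneg_nonpos A_nonneg \<sigma>(1))
  ultimately have "K * (2 * (\<Sum>i\<in>UNIV. G i r * d $ i)) + (\<Sum>i\<in>UNIV. \<Sum>k\<in>UNIV. a r i k * (d $ i * (\<sigma> i - \<sigma> k))) \<le> 0"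
    using K by (intro add_nonpos_nonpos mult_nonneg_nonpos) auto
  then show "straddle_slope_le (W K) r 0"
    unfolding W_def
    by (rule straddle_slope_le_mono[OF straddle_slope_le_add[OF
          straddle_slope_le_derivative[OF DERIV_cmult[OF V_derivative[OF d]]] \<sigma>(4)]])
qed

text \<open>While \<open>G j\<close> is at least \<open>\<epsilon>\<close>, agent \<open>j\<close>
  can only move down. The slope of \<open>- G j\<close> has two parts. The part
  \<open>\<Sum>k. a r j k * d $ k\<close> is absorbed by the cancellation of gradient mass on the
  edges at \<open>j\<close>; the part caused by \<open>d $ j\<close> has size at most
  \<open>B * \<bar>d $ j\<bar>\<close> and is paid by the energy, which falls at rate at least
  \<open>2 * \<epsilon> * \<bar>d $ j\<bar>\<close>.\<close>

lemma W_minus_G_nonincreasing: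
  assumes K: "0 \<le> K" "B \<le> 2 * K * \<epsilon>" and B: "\<And>t i. 0 \<le> t \<Longrightarrow> (\<Sum>k\<in>UNIV. a t i k) \<le> B"
    and \<epsilon>: "0 < \<epsilon>" and st: "0 \<le> s" "s \<le> t"
    and large: "\<And>r. s < r \<Longrightarrow> r < t \<Longrightarrow> \<epsilon> \<le> G j r"
  shows "W K t - G j t \<le> W K s - G j s"
proof (rule nonincreasing[OF st lipschitz_along_diff[OF lipschitz_along_W[OF st(1)] lipschitz_along_G[OF st(1)]]])
  fix r d assume r: "s < r" "r < t" and d: "velocity r d"
  obtain \<sigma> where \<sigma>: "\<And>i k. d $ i * (\<sigma> i - \<sigma> k) \<le> 0" "\<And>i. 0 < G i r \<Longrightarrow> \<sigma> i = 1" "\<And>i. d $ i * \<sigma> i \<le> 0"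
    "straddle_slope_le (\<lambda>r. \<Sum>i\<in>UNIV. \<bar>G i r\<bar>) r (\<Sum>i\<in>UNIV. \<Sum>k\<in>UNIV. a r i k * (d $ i * (\<sigma> i - \<sigma> k)))"
    using gradient_norm_slope[OF d] by blast
  have Gj: "\<epsilon> \<le> G j r" using large[OF r] .
  then have \<sigma>j: "\<sigma> j = 1" and dj: "d $ j \<le> 0"
    using \<epsilon> \<sigma>(2)[of j] \<sigma>(3)[of j] by auto
  let ?P = "\<Sum>i\<in>UNIV. \<Sum>k\<in>UNIV. a r i k * (d $ i * (\<sigma> i - \<sigma> k))"
  \<comment> \<open>All summands are nonpositive, so for each agent \<open>i\<close> only the one
    with \<open>k = j\<close> is kept.\<close>
  have "?P \<le> (\<Sum>i\<in>UNIV. a r i j * (d $ i * (\<sigma> i - \<sigma> j)))"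
  proof (rule sum_mono)
    fix i
    have "(\<Sum>k\<in>UNIV - {j}. a r i k * (d $ i * (\<sigma> i - \<sigma> k))) \<le> 0"
      by (intro sum_nonpos mult_nonneg_nonpos A_nonneg \<sigma>(1))
    then show "(\<Sum>k\<in>UNIV. a r i k * (d $ i * (\<sigma> i - \<sigma> k))) \<le> a r i j * (d $ i * (\<sigma> i - \<sigma> j))"
      by (simp add: sum.remove[of UNIV j])
  qed
  also have "\<dots> = (\<Sum>i\<in>UNIV. a r i j * (d $ i * \<sigma> i)) - (\<Sum>i\<in>UNIV. a r i j * d $ i)"
    by (simp add: \<sigma>j algebra_simps flip: sum_subtractf)
  also have "\<dots> \<le> - (\<Sum>i\<in>UNIV. a r j i * d $ i)"
  proof -
    have "(\<Sum>i\<in>UNIV. a r i j * (d $ i * \<sigma> i)) \<le> 0"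
      by (intro sum_nonpos mult_nonneg_nonpos A_nonneg \<sigma>(3))
    moreover have "(\<Sum>i\<in>UNIV. a r i j * d $ i) = (\<Sum>i\<in>UNIV. a r j i * d $ i)"
      by (subst a_sym) (rule refl)
    ultimately show ?thesis by simp
  qed
  finally have P: "?P \<le> - (\<Sum>i\<in>UNIV. a r j i * d $ i)" .
  \<comment> \<open>Of the energy dissipation only the share of agent \<open>j\<close> is
    kept.\<close>
  have "(\<Sum>i\<in>UNIV - {j}. G i r * d $ i) \<le> 0" using V_rate_nonpos[OF d] by (intro sum_nonpos) auto
  then have "(\<Sum>i\<in>UNIV. G i r * d $ i) \<le> G j r * d $ j" by (simp add: sum.remove[of UNIV j])
  also have "\<dots> \<le> \<epsilon> * d $ j" using Gj dj by (rule mult_right_mono_neg)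
  finally have "K * (2 * (\<Sum>i\<in>UNIV. G i r * d $ i)) \<le> K * (2 * (\<epsilon> * d $ j))"
    using K(1) by (intro mult_left_mono) auto
  also have "\<dots> = (2 * K * \<epsilon>) * d $ j" by simp
  also have "\<dots> \<le> B * d $ j" using K(2) dj by (rule mult_right_mono_neg)
  also have "\<dots> \<le> (\<Sum>k\<in>UNIV. a r j k) * d $ j"
    using B[of r j] r(1) st(1) dj by (intro mult_right_mono_neg) auto
  finally have "K * (2 * (\<Sum>i\<in>UNIV. G i r * d $ i)) + ?P + - (\<Sum>k\<in>UNIV. a r j k * (d $ j - d $ k)) \<le> 0"
    using P by (simp add: right_diff_distrib sum_subtractf sum_distrib_right)
  then show "straddle_slope_le (\<lambda>r. W K r - G j r) r 0"
    unfolding W_def diff_conv_add_uminus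
    by (rule straddle_slope_le_mono[OF straddle_slope_le_add[OF straddle_slope_le_add[OF
          straddle_slope_le_derivative[OF DERIV_cmult[OF V_derivative[OF d]]] \<sigma>(4)]
          straddle_slope_le_derivative[OF DERIV_minus[OF G_derivative[OF d]]]],
          unfolded diff_conv_add_uminus])
qed

lemma continuous_edge_gradient: "continuous_on UNIV (\<lambda>x. edge_gradient F x i)"
  unfolding edge_gradient_def
  by (intro continuous_intros continuous_on_compose2[OF F_continuous]) auto

lemma G_continuous: "continuous_on {0..} (G i)"
  by (rule continuous_on_compose2[OF continuous_edge_gradient y_continuous]) auto

text \<open>Wait until \<open>W K\<close> is within \<open>\<epsilon>\<close> of its limit. A fall
  of \<open>G j\<close> from \<open>2 * \<epsilon>\<close> to \<open>\<epsilon>\<close> would then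
  drag \<open>W K\<close> below the limit, since \<open>W K - G j\<close> does not increase
  meanwhile.\<close>

lemma large_gradient_persists:
  assumes \<epsilon>: "0 < \<epsilon>" and freq: "\<And>T. \<exists>t\<ge>T. 2 * \<epsilon> \<le> G j t"
  obtains t0 where "0 \<le> t0" "\<And>t. t0 \<le> t \<Longrightarrow> \<epsilon> \<le> G j t"
proof -
  obtain B where B: "\<And>t i. 0 \<le> t \<Longrightarrow> (\<Sum>k\<in>UNIV. a t i k) \<le> B" "0 \<le> B" by (rule stiffness_bounded) blast
  \<comment> \<open>Chosen so that \<open>B = 2 * K * \<epsilon>\<close>, the least weight for which
    the energy pays for the motion of agent \<open>j\<close>.\<close>
  define K where "K = B / (2 * \<epsilon>)"
  have K: "0 \<le> K" "B \<le> 2 * K * \<epsilon>" using B(2) \<epsilon> by (auto simp: K_def)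
  have W0: "0 \<le> W K t" for t unfolding W_def using K(1) V_nonneg by (intro add_nonneg_nonneg mult_nonneg_nonneg sum_nonneg) auto
  obtain l where l: "(W K \<longlongrightarrow> l) at_top" "\<And>t. 0 \<le> t \<Longrightarrow> l \<le> W K t"
    using nonincreasing_bounded_below_convergent[of 0 "W K" 0] W_nonincreasing[OF K(1)] W0 by metis
  from order_tendstoD(2)[OF l(1), of "l + \<epsilon>"] \<epsilon>
  obtain T where T: "\<And>t. T \<le> t \<Longrightarrow> W K t < l + \<epsilon>" by (auto simp: eventually_at_top_linorder)
  obtain t0 where t0: "max T 0 \<le> t0" "2 * \<epsilon> \<le> G j t0" using freq by blast
  have "\<epsilon> \<le> G j t" if t: "t0 \<le> t" for t
  proof (rule ccontr)
    assume "\<not> \<epsilon> \<le> G j t"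
    \<comment> \<open>This compact set has a least element \<open>m\<close>, the first time at which
      \<open>G j\<close> is at most \<open>\<epsilon>\<close>; before \<open>m\<close> the threshold
      hypothesis holds.\<close>
    define S where "S = {t0..t} \<inter> G j -` {..\<epsilon>}"
    have "continuous_on {t0..t} (G j)" by (rule continuous_on_subset[OF G_continuous]) (use t0 in auto)
    then have "closed S" unfolding S_def by (intro continuous_closed_preimage) auto
    moreover have "bounded S" unfolding S_def by (intro bounded_Int) auto
    moreover have "t \<in> S" using \<open>\<not> \<epsilon> \<le> G j t\<close> t by (auto simp: S_def)
    ultimately obtain m where m: "m \<in> S" "\<And>r. r \<in> S \<Longrightarrow> m \<le> r"
      using compact_attains_inf[of S] by (auto simp: compact_eq_bounded_closed)
    have "W K m - G j m \<le> W K t0 - G j t0"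
    proof (rule W_minus_G_nonincreasing[OF K B(1) \<epsilon>])
      show "\<epsilon> \<le> G j r" if "t0 < r" "r < m" for r
      proof (rule ccontr)
        assume "\<not> \<epsilon> \<le> G j r"
        then have "r \<in> S" using that m(1) by (auto simp: S_def)
        with m(2) that show False by fastforce
      qed
    qed (use t0 m(1) in \<open>auto simp: S_def\<close>)
    moreover have "l \<le> W K m" using l(2)[of m] m(1) t0(1) by (auto simp: S_def)
    moreover have "W K t0 < l + \<epsilon>" using T t0(1) by simp
    moreover have "G j m \<le> \<epsilon>" using m(1) by (simp add: S_def)
    ultimately show False using t0(2) by linarith
  qed
  moreover have "0 \<le> t0" using t0(1) by simp
  ultimately show thesis using that by blast
qed

text \<open>With \<open>G j\<close> eventually above \<open>\<epsilon>\<close>, the coordinate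
  \<open>y t $ j\<close> only decreases, and each unit of decrease costs at least
  \<open>2 * \<epsilon>\<close> of energy. As the energy is nonnegative, the coordinate is bounded
  below.\<close>

lemma component_converges_if_gradient_pos:
  assumes \<epsilon>: "0 < \<epsilon>" and freq: "\<And>T. \<exists>t\<ge>T. 2 * \<epsilon> \<le> G j t"
  shows "\<exists>l. ((\<lambda>t. y t $ j) \<longlongrightarrow> l) at_top"
proof -
  obtain t0 where t0: "0 \<le> t0" "\<And>t. t0 \<le> t \<Longrightarrow> \<epsilon> \<le> G j t"
    using large_gradient_persists[OF assms] by blast
  have dj: "d $ j \<le> 0" if "velocity r d" "t0 < r" for r d
    using that t0(2)[of r] \<epsilon> unfolding velocity_def by (smt (verit, best))
  have mono: "y t $ j \<le> y s $ j" if "t0 \<le> s" "s \<le> t" for s t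
  proof (rule nonincreasing[OF _ that(2) lipschitz_along_component])
    show "0 \<le> s" using that t0 by simp
    fix r d assume "s < r" and d: "velocity r d"
    with that dj[OF d] have "d $ j \<le> 0" by simp
    then show "straddle_slope_le (\<lambda>t. y t $ j) r 0"
      by (rule straddle_slope_le_mono[OF straddle_slope_le_derivative[OF component_derivative[OF d]]])
  qed
  have "1 / (2 * \<epsilon>) * V t - y t $ j \<le> 1 / (2 * \<epsilon>) * V t0 - y t0 $ j" if "t0 \<le> t" for t
  proof (rule nonincreasing[OF t0(1) that lipschitz_along_diff[OF lipschitz_along_cmult[OF lipschitz_along_V[OF t0(1)]] lipschitz_along_component]])
    fix r d assume r: "t0 < r" and d: "velocity r d"
    have "(\<Sum>i\<in>UNIV - {j}. G i r * d $ i) \<le> 0" using V_rate_nonpos[OF d] by (intro sum_nonpos) auto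
    then have "(\<Sum>i\<in>UNIV. G i r * d $ i) \<le> G j r * d $ j" by (simp add: sum.remove[of UNIV j])
    also have "\<dots> \<le> \<epsilon> * d $ j" using t0(2) r dj[OF d r] by (intro mult_right_mono_neg) auto
    finally have "1 / (2 * \<epsilon>) * (2 * (\<Sum>i\<in>UNIV. G i r * d $ i)) - d $ j \<le> 0"
      using \<epsilon> by (simp add: field_simps)
    then show "straddle_slope_le (\<lambda>t. 1 / (2 * \<epsilon>) * V t - y t $ j) r 0"
      by (rule straddle_slope_le_mono[OF straddle_slope_le_derivative[OF DERIV_diff[OF
              DERIV_cmult[OF V_derivative[OF d]] component_derivative[OF d]]]])
  qed
  moreover have "0 \<le> 1 / (2 * \<epsilon>) * V t" for t using \<epsilon> V_nonneg[of t] by simp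
  ultimately have "y t0 $ j - 1 / (2 * \<epsilon>) * V t0 \<le> y t $ j" if "t0 \<le> t" for t
    using that by (smt (verit, best))
  with mono show ?thesis
    using nonincreasing_bounded_below_convergent[of t0 "\<lambda>t. y t $ j"] by metis
qed

section \<open>Reflection of the line and both signs of the gradient\<close>

lemma reflected_gradient: "edge_gradient (\<lambda>i j. F j i) (- x) i = - edge_gradient F x i"
  unfolding edge_gradient_def sum_negf[symmetric] by (rule sum.cong[OF refl]) (simp add: F_sym[of i])

text \<open>Negating all positions and exchanging the indices of \<open>f\<close> gives a system of
  the same kind with negated gradient. One-sided results thus yield their mirror images.\<close>

lemma reflected: "sign_descent E (\<lambda>i j. f j i) (\<lambda>i j. F j i) (\<lambda>i j. A j i) (\<lambda>t. - y t)"
proof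
  show "absolutely_continuous_on {0..T} (\<lambda>t. - y t)" if "0 \<le> T" for T
    using y_ac[OF that] unfolding absolutely_continuous_on_def by (simp add: dist_minus)
  show "AE t in lebesgue. 0 < t \<longrightarrow> (\<exists>d. ((\<lambda>t. - y t) has_vector_derivative d) (at t) \<and>
      (\<forall>i. (0 < d $ i \<longrightarrow> edge_gradient (\<lambda>i j. F j i) (- y t) i < 0) \<and>
           (d $ i < 0 \<longrightarrow> 0 < edge_gradient (\<lambda>i j. F j i) (- y t) i)))"
    using descent
  proof eventually_elim
    case (elim t)
    show ?case
    proof
      assume "0 < t"
      with elim obtain d where "velocity t d" unfolding velocity_def by blast
      then show "\<exists>d. ((\<lambda>t. - y t) has_vector_derivative d) (at t) \<and>
        (\<forall>i. (0 < d $ i \<longrightarrow> edge_gradient (\<lambda>i j. F j i) (- y t) i < 0) \<and>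
           (d $ i < 0 \<longrightarrow> 0 < edge_gradient (\<lambda>i j. F j i) (- y t) i))"
        unfolding velocity_def reflected_gradient by (intro exI[of _ "- d"]) (auto intro: has_vector_derivative_minus)
    qed
  qed
qed (use connected E_sym f_deriv F_deriv A_cont A_nonneg A_pos f_nonneg f_coercive in
      \<open>auto intro: f_sym\<close>)

text \<open>If \<open>\<bar>G j t\<bar>\<close> is at least \<open>e\<close> at arbitrarily late
  times, then so is \<open>G j t\<close> or its negative. The second case is the first one for the
  reflected system.\<close>

lemma component_converges:
  assumes "\<not> (G j \<longlongrightarrow> 0) at_top"
  shows "\<exists>l. ((\<lambda>t. y t $ j) \<longlongrightarrow> l) at_top"
proof -
  interpret R: sign_descent E "\<lambda>i j. f j i" "\<lambda>i j. F j i" "\<lambda>i j. A j i" "\<lambda>t. - y t"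
    by (rule reflected)
  obtain e where e: "0 < e" "\<not> (\<forall>\<^sub>F t in at_top. dist (G j t) 0 < e)"
    using assms by (auto simp: tendsto_iff)
  then have freq: "\<exists>t\<ge>T. e \<le> \<bar>G j t\<bar>" for T
    by (auto simp: eventually_at_top_linorder not_less)
  show ?thesis
  proof (cases "\<forall>T. \<exists>t\<ge>T. e \<le> G j t")
    case True
    then show ?thesis using component_converges_if_gradient_pos[of "e / 2" j] e(1) by simp
  next
    case False
    then obtain T where T: "\<And>t. T \<le> t \<Longrightarrow> G j t < e" by (meson not_le)
    have "\<exists>t\<ge>S. e \<le> - G j t" for S
    proof -
      obtain t where "max S T \<le> t" "e \<le> \<bar>G j t\<bar>" using freq by blast
      with T[of t] show ?thesis by (intro exI[of _ t]) auto
    qed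
    then have "\<exists>l. ((\<lambda>t. (- y t) $ j) \<longlongrightarrow> l) at_top"
      using R.component_converges_if_gradient_pos[of "e / 2" j] e(1) by (simp add: reflected_gradient)
    then obtain l where "((\<lambda>t. - (y t $ j)) \<longlongrightarrow> l) at_top" by auto
    from tendsto_minus[OF this] show ?thesis by auto
  qed
qed

section \<open>Stationary points and boundedness of the trajectory\<close>

text \<open>A maximum principle. Seen from an agent of largest deviation, all differences to other
  agents are at most those of \<open>z\<close>. By monotonicity of \<open>F\<close> its gradient is
  at least that of \<open>z\<close>, namely zero, so it cannot move up.\<close>

lemma Max_deviation_nonincreasing:
  assumes z: "\<And>i. edge_gradient F z i = 0" and st: "0 \<le> s" "s \<le> t"
  shows "Max (range (\<lambda>i. y t $ i - z $ i)) \<le> Max (range (\<lambda>i. y s $ i - z $ i))"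
proof (rule nonincreasing[OF st lipschitz_along_Max_diff])
  fix r d assume d: "velocity r d"
  show "straddle_slope_le (\<lambda>t. Max (range (\<lambda>i. y t $ i - z $ i))) r 0"
  proof (rule straddle_slope_le_Max)
    show "((\<lambda>t. y t $ i - z $ i) has_real_derivative d $ i - 0) (at r)" for i
      by (intro DERIV_diff component_derivative[OF d] DERIV_const)
    fix i assume i: "y r $ i - z $ i = Max (range (\<lambda>j. y r $ j - z $ j))"
    have "y r $ j - z $ j \<le> y r $ i - z $ i" for j unfolding i by (rule Max_ge) auto
    then have "F i j (y r $ j - y r $ i) \<le> F i j (z $ j - z $ i)" for j
      by (intro F_mono) (simp add: algebra_simps)
    then have "edge_gradient F z i \<le> G i r" unfolding edge_gradient_def by (intro sum_mono) simp
    with z d show "d $ i - 0 \<le> 0" unfolding velocity_def by (metis diff_zero leD not_le_imp_less)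
  qed
qed

lemma bounded_above_if_stationary:
  assumes z: "\<And>i. edge_gradient F z i = 0"
  obtains C where "\<And>t i. 0 \<le> t \<Longrightarrow> y t $ i \<le> C"
proof -
  define m where "m = Max (range (\<lambda>i. y 0 $ i - z $ i))"
  have "y t $ i \<le> m + Max (range (($) z))" if "0 \<le> t" for t i
  proof -
    have "y t $ i - z $ i \<le> Max (range (\<lambda>i. y t $ i - z $ i))" by (rule Max_ge) auto
    also have "\<dots> \<le> m" unfolding m_def by (rule Max_deviation_nonincreasing[OF z]) (use that in auto)
    finally have "y t $ i \<le> m + z $ i" by simp
    moreover have "z $ i \<le> Max (range (($) z))" by (rule Max_ge) auto
    ultimately show ?thesis by linarith
  qed
  then show thesis by (rule that)
qed

text \<open>Let \<open>c\<close> be the difference of the points and \<open>\<omega>\<close> that of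
  their edge forces. Monotonicity makes every \<open>\<omega> i j * (c j - c i)\<close> nonnegative,
  while summation by parts turns their sum into gradient differences times \<open>c i\<close>, each
  zero by hypothesis. So all terms vanish; strict monotonicity makes \<open>c\<close> constant
  across edges, and connectedness makes it constant.\<close>

lemma gradient_eq_imp_translate:
  assumes "\<And>i. u $ i = v $ i \<or> edge_gradient F u i = edge_gradient F v i"
  shows "u $ i - v $ i = u $ j - v $ j"
proof -
  define \<omega> where "\<omega> i j = F i j (u $ j - u $ i) - F i j (v $ j - v $ i)" for i j
  define c where "c i = u $ i - v $ i" for i
  have anti: "\<omega> i j = - \<omega> j i" for i j
    unfolding \<omega>_def using F_sym[of i j "u $ j - u $ i"] F_sym[of i j "v $ j - v $ i"] by simp
  have pos: "0 \<le> \<omega> i j * (c j - c i)" for i j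
  proof (cases "c i \<le> c j")
    case True
    then have "v $ j - v $ i \<le> u $ j - u $ i" by (simp add: c_def)
    from F_mono[OF this] True show ?thesis by (simp add: \<omega>_def)
  next
    case False
    then have "u $ j - u $ i \<le> v $ j - v $ i" by (simp add: c_def)
    from F_mono[OF this] False show ?thesis by (simp add: \<omega>_def mult_nonpos_nonpos)
  qed
  have "(\<Sum>j\<in>UNIV. - \<omega> i j) * c i = 0" for i
  proof -
    have "(\<Sum>j\<in>UNIV. - \<omega> i j) = edge_gradient F u i - edge_gradient F v i"
      by (simp add: \<omega>_def edge_gradient_def sum_subtractf sum_negf)
    with assms[of i] show ?thesis by (auto simp: c_def)
  qed
  then have "(\<Sum>i\<in>UNIV. \<Sum>j\<in>UNIV. \<omega> i j * (c j - c i)) = 0"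
    unfolding sum_antisymmetric[of \<omega> c, OF anti] by (simp only: sum.neutral_const mult_zero_right)
  then have zero: "\<omega> i j * (c j - c i) = 0" for i j
    using pos by (simp add: sum_nonneg_eq_0_iff sum_nonneg)
  have edge: "c i = c j" if E: "E i j" for i j
  proof (rule ccontr)
    assume "c i \<noteq> c j"
    then consider "v $ j - v $ i < u $ j - u $ i" | "u $ j - u $ i < v $ j - v $ i"
      by (fastforce simp: c_def)
    then have "\<omega> i j \<noteq> 0"
      using F_strict_mono[OF E] by cases (fastforce simp: \<omega>_def)+
    with zero[of i j] \<open>c i \<noteq> c j\<close> show False by simp
  qed
  have "c i = c j"
    using connected[of i j] by (induction rule: rtranclp_induct) (auto dest: edge)
  then show ?thesis by (simp add: c_def)
qed

text \<open>The trajectory is not yet known to be bounded, but its differences are. The gradient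
  depends on differences alone, so the positions relative to a fixed agent \<open>k\<close> have a
  cluster point, where the gradient vanishes.\<close>

lemma stationary_point_exists:
  assumes G0: "\<And>i. (G i \<longlongrightarrow> 0) at_top"
  obtains z where "\<And>i. edge_gradient F z i = 0"
proof -
  fix k :: 'n
  define x where "x n = (\<chi> i. y (real n) $ i - y (real n) $ k)" for n
  obtain C where C: "\<And>t i j. 0 \<le> t \<Longrightarrow> \<bar>y t $ j - y t $ i\<bar> \<le> C" by (rule differences_bounded) blast
  have "bounded (range x)"
    unfolding bounded_iff
  proof (intro exI ballI)
    fix w assume "w \<in> range x"
    then obtain n where w: "w = x n" by blast
    have "norm w \<le> (\<Sum>i\<in>UNIV. \<bar>w $ i\<bar>)" by (rule norm_le_l1_cart)
    also have "\<dots> \<le> (\<Sum>i\<in>(UNIV :: 'n set). C)" using C by (intro sum_mono) (simp add: w x_def)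
    finally show "norm w \<le> (\<Sum>i\<in>(UNIV :: 'n set). C)" .
  qed
  then obtain z r where r: "strict_mono (r :: nat \<Rightarrow> nat)" "(x \<circ> r) \<longlonglongrightarrow> z"
    using bounded_imp_convergent_subsequence by blast
  have "edge_gradient F z i = 0" for i
  proof (rule LIMSEQ_unique)
    show "(\<lambda>n. edge_gradient F ((x \<circ> r) n) i) \<longlonglongrightarrow> edge_gradient F z i"
      using continuous_edge_gradient r(2) by (rule continuous_on_tendsto_compose) auto
    have "filterlim (\<lambda>n. real (r n)) at_top sequentially"
      by (rule filterlim_compose[OF filterlim_real_sequentially filterlim_subseq[OF r(1)]])
    then have "(\<lambda>n. G i (real (r n))) \<longlonglongrightarrow> 0" by (rule filterlim_compose[OF G0])
    moreover have "edge_gradient F ((x \<circ> r) n) i = G i (real (r n))" for n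
      by (simp add: edge_gradient_def x_def)
    ultimately show "(\<lambda>n. edge_gradient F ((x \<circ> r) n) i) \<longlonglongrightarrow> 0" by simp
  qed
  then show thesis by (rule that)
qed

text \<open>If all gradients tend to zero, a stationary point controls deviations from above and, by
  reflection, from below. Otherwise some component converges, and all others stay within bounded
  distance of it.\<close>

lemma eventually_bounded: "\<exists>T. bounded (y ` {T..})"
proof -
  have "\<exists>T c. \<forall>t\<ge>T. \<forall>i. \<bar>y t $ i\<bar> \<le> c"
  proof (cases "\<forall>i. (G i \<longlongrightarrow> 0) at_top")
    case True
    interpret R: sign_descent E "\<lambda>i j. f j i" "\<lambda>i j. F j i" "\<lambda>i j. A j i" "\<lambda>t. - y t"
      by (rule reflected)
    obtain z where z: "\<And>i. edge_gradient F z i = 0" using stationary_point_exists True by blast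
    obtain C where C: "\<And>t i. 0 \<le> t \<Longrightarrow> y t $ i \<le> C" using bounded_above_if_stationary[OF z] by blast
    \<comment> \<open>The point \<open>- z\<close> is stationary for the reflected system.\<close>
    obtain C' where C': "\<And>t i. 0 \<le> t \<Longrightarrow> - (y t $ i) \<le> C'"
      using R.bounded_above_if_stationary[of "- z"] z by (auto simp: reflected_gradient)
    have "\<bar>y t $ i\<bar> \<le> max C C'" if "0 \<le> t" for t i
      using C[OF that, of i] C'[OF that, of i] by linarith
    then show ?thesis by blast
  next
    case False
    then obtain j l where l: "((\<lambda>t. y t $ j) \<longlongrightarrow> l) at_top" using component_converges by blast
    obtain C where C: "\<And>t i j. 0 \<le> t \<Longrightarrow> \<bar>y t $ j - y t $ i\<bar> \<le> C" by (rule differences_bounded) blast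
    have "\<forall>\<^sub>F t in at_top. dist (y t $ j) l < 1" using l by (rule tendstoD) simp
    then obtain T where T: "\<And>t. T \<le> t \<Longrightarrow> dist (y t $ j) l < 1" by (auto simp: eventually_at_top_linorder)
    have "\<bar>y t $ i\<bar> \<le> \<bar>l\<bar> + 1 + C" if "max T 0 \<le> t" for t i
      using T[of t] C[of t i j] that by (simp add: dist_real_def)
    then show ?thesis by blast
  qed
  then obtain T c where c: "\<And>t i. T \<le> t \<Longrightarrow> \<bar>y t $ i\<bar> \<le> c" by blast
  have "norm (y t) \<le> (\<Sum>i\<in>(UNIV :: 'n set). c)" if "T \<le> t" for t
  proof -
    have "norm (y t) \<le> (\<Sum>i\<in>UNIV. \<bar>y t $ i\<bar>)" by (rule norm_le_l1_cart)
    also have "\<dots> \<le> (\<Sum>i\<in>(UNIV :: 'n set). c)" using c[OF that] by (rule sum_mono)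
    finally show ?thesis .
  qed
  then have "bounded (y ` {T..})" unfolding bounded_iff by blast
  then show ?thesis by blast
qed

section \<open>Uniqueness of cluster points and convergence\<close>

text \<open>Once the trajectory is within \<open>e\<close> of the stationary point \<open>l\<close>,
  its largest deviation from \<open>l\<close> is at most \<open>e\<close> and remains so. Hence no
  cluster point exceeds \<open>l\<close> by more than \<open>e\<close> in any coordinate.\<close>

lemma stationary_cluster_points_le:
  assumes S: "filterlim S at_top sequentially" "(\<lambda>n. y (S n)) \<longlonglongrightarrow> l"
    and T: "filterlim T at_top sequentially" "(\<lambda>n. y (T n)) \<longlonglongrightarrow> l'"
    and l: "\<And>i. edge_gradient F l i = 0"
  shows "l' $ i \<le> l $ i"
proof (rule field_le_epsilon)
  fix e :: real assume e: "0 < e"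
  have "\<forall>\<^sub>F n in sequentially. 0 \<le> S n \<and> dist (y (S n)) l < e"
    using eventually_conj[OF S(1)[unfolded filterlim_at_top, rule_format, of 0] tendstoD[OF S(2) e]] .
  then obtain n where n: "0 \<le> S n" "dist (y (S n)) l < e" by (auto simp: eventually_sequentially)
  obtain k where k: "y (S n) $ k - l $ k = Max (range (\<lambda>i. y (S n) $ i - l $ i))"
    by (rule Max_range_attained)
  have M: "Max (range (\<lambda>i. y (S n) $ i - l $ i)) \<le> e"
    using component_le_norm_cart[of "y (S n) - l" k] n(2) unfolding k[symmetric] by (simp add: dist_norm)
  have "y t $ i \<le> l $ i + e" if "S n \<le> t" for t
  proof -
    have "y t $ i - l $ i \<le> Max (range (\<lambda>i. y t $ i - l $ i))" by (rule Max_ge) auto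
    also have "\<dots> \<le> Max (range (\<lambda>i. y (S n) $ i - l $ i))"
      by (rule Max_deviation_nonincreasing[OF l n(1) that])
    also note M
    finally show ?thesis by simp
  qed
  moreover have "\<forall>\<^sub>F m in sequentially. S n \<le> T m" using T(1) by (simp add: filterlim_at_top)
  ultimately have "\<forall>\<^sub>F m in sequentially. y (T m) $ i \<le> l $ i + e" by (auto elim: eventually_mono)
  then show "l' $ i \<le> l $ i + e"
    by (intro tendsto_upperbound[OF tendsto_vec_nth[OF T(2)]]) auto
qed

lemma converges: "\<exists>l. (y \<longlongrightarrow> l) at_top"
proof -
  obtain T0 where T0: "bounded (y ` {T0..})" using eventually_bounded by blast
  show ?thesis
  proof (rule tendsto_if_unique_cluster_point[OF T0])
    fix S T l l'
    assume S: "filterlim S at_top sequentially" "(\<lambda>n. y (S n)) \<longlonglongrightarrow> l"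
      and T: "filterlim T at_top sequentially" "(\<lambda>n. y (T n)) \<longlonglongrightarrow> l'"
    have grad0: "edge_gradient F x i = 0"
      if "(G i \<longlongrightarrow> 0) at_top" "filterlim R at_top sequentially" "(\<lambda>n. y (R n)) \<longlonglongrightarrow> x" for i R x
    proof (rule LIMSEQ_unique)
      show "(\<lambda>n. G i (R n)) \<longlonglongrightarrow> 0" using that(1,2) by (rule filterlim_compose)
      show "(\<lambda>n. G i (R n)) \<longlonglongrightarrow> edge_gradient F x i"
        using continuous_edge_gradient that(3) by (rule continuous_on_tendsto_compose) auto
    qed
    have comp: "l $ i = l' $ i" if i: "\<not> (G i \<longlongrightarrow> 0) at_top" for i
    proof -
      obtain c where c: "((\<lambda>t. y t $ i) \<longlongrightarrow> c) at_top" using component_converges[OF i] by blast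
      have "l $ i = c" "l' $ i = c"
        using LIMSEQ_unique[OF tendsto_vec_nth filterlim_compose[OF c]] S T by blast+
      then show ?thesis by simp
    qed
    \<comment> \<open>Each agent falls under one alternative: a converging component has the same
      value in both cluster points, and a vanishing gradient is zero at both.\<close>
    have trans: "l $ i - l' $ i = l $ j - l' $ j" for i j
      by (rule gradient_eq_imp_translate) (use comp grad0 S T in metis)
    show "l = l'"
    proof (cases "\<forall>i. (G i \<longlongrightarrow> 0) at_top")
      case True
      then have "edge_gradient F l i = 0" "edge_gradient F l' i = 0" for i using grad0 S T by blast+
      then show ?thesis
        using stationary_cluster_points_le[OF S T] stationary_cluster_points_le[OF T S]
        by (simp add: vec_eq_iff order_antisym)
    next
      case False
      then obtain j where "l $ j = l' $ j" using comp by blast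
      with trans[of _ j] show ?thesis by (simp add: vec_eq_iff)
    qed
  qed
qed

end

subsection \<open>The multi-agent system\<close>

text \<open>Subtracting \<open>m / 2 * z\<^sup>2\<close> leaves a convex function. Its derivative is
  therefore monotone near \<open>x\<close>, so that \<open>A - m\<close> is nonnegative.\<close>

lemma strongly_convex_imp_second_derivative_pos:
  assumes f: "\<And>z. (f has_real_derivative F z) (at z)"
    and F: "(F has_real_derivative A) (at x)"
    and convex: "locally_strongly_convex f"
  shows "0 < A"
proof -
  \<comment> \<open>The radius 2 leaves a margin: the tangent inequality is needed at interior
    points and is used within radius 1.\<close>
  obtain m where m: "0 < m" "strongly_convex_on m {x - 2..x + 2} f"
    using convex unfolding locally_strongly_convex_def by blast
  define g where "g z = f z - m / 2 * z\<^sup>2" for z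
  have g: "(g has_real_derivative F z - m * z) (at z)" for z
    unfolding g_def by (auto intro!: derivative_eq_intros f)
  have "convex_on {x - 2..x + 2} g"
  proof (rule convex_onI)
    fix s u v :: real
    assume "0 < s" "s < 1" "u \<in> {x - 2..x + 2}" "v \<in> {x - 2..x + 2}"
    then have "f ((1 - s) * u + s * v) \<le> (1 - s) * f u + s * f v - m / 2 * s * (1 - s) * (u - v)\<^sup>2"
      using m(2) unfolding strongly_convex_on_def by auto
    \<comment> \<open>The convexity defect of the quadratic equals the strong convexity term
      exactly.\<close>
    moreover have "m / 2 * ((1 - s) * u + s * v)\<^sup>2
        = (1 - s) * (m / 2 * u\<^sup>2) + s * (m / 2 * v\<^sup>2) - m / 2 * s * (1 - s) * (u - v)\<^sup>2"
      by (simp add: field_simps power2_eq_square)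
    moreover have "(1 - s) * g u + s * g v
        = (1 - s) * f u + s * f v - ((1 - s) * (m / 2 * u\<^sup>2) + s * (m / 2 * v\<^sup>2))"
      by (simp add: g_def right_diff_distrib)
    ultimately have "g ((1 - s) * u + s * v) \<le> (1 - s) * g u + s * g v"
      unfolding g_def[of "(1 - s) * u + s * v"] by linarith
    then show "g ((1 - s) *\<^sub>R u + s *\<^sub>R v) \<le> (1 - s) * g u + s * g v" by simp
  qed simp
  then have tangent: "(F u - m * u) * (v - u) \<le> g v - g u" if "u \<in> {x - 1..x + 1}" "v \<in> {x - 1..x + 1}" for u v
    using that by (intro convex_on_imp_above_tangent[of "{x - 2..x + 2}"])
      (auto simp: interior_atLeastAtMost_real intro: has_field_derivative_at_within g)
  have "mono_on {x - 1..x + 1} (\<lambda>z. F z - m * z)"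
  proof (rule mono_onI)
    fix u v assume uv: "u \<in> {x - 1..x + 1}" "v \<in> {x - 1..x + 1}" "u \<le> v"
    \<comment> \<open>This is the sum of the tangent inequalities at \<open>u\<close> and at
      \<open>v\<close>.\<close>
    have "(F u - m * u) * (v - u) \<le> (F v - m * v) * (v - u)"
      using tangent[OF uv(1,2)] tangent[OF uv(2,1)] by (simp add: algebra_simps)
    then show "F u - m * u \<le> F v - m * v"
      using uv(3) by (cases "u = v") (auto simp: mult_le_cancel_right)
  qed
  moreover have "((\<lambda>z. F z - m * z) has_real_derivative A - m) (at x)"
    by (auto intro!: derivative_eq_intros F)
  ultimately have "0 \<le> A - m"
    by (rule mono_on_imp_deriv_nonneg) (simp add: interior_atLeastAtMost_real)
  with m(1) show ?thesis by simp
qed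

text \<open>The tangents at \<open>z0 + 1\<close> and \<open>z0 - 1\<close> have positive and
  negative slope, and \<open>f\<close> lies above both. So it grows at least linearly in both
  directions.\<close>

lemma convex_with_minimum_coercive:
  fixes f :: "real \<Rightarrow> real"
  assumes f: "\<And>z. (f has_real_derivative F z) (at z)"
    and F: "\<And>z. (F has_real_derivative A z) (at z)"
    and A: "\<And>z. 0 < A z" and nonneg: "\<And>z. 0 \<le> f z" and min: "\<And>z. f z0 \<le> f z"
  shows "\<exists>C. \<forall>z. f z \<le> c \<longrightarrow> \<bar>z\<bar> \<le> C"
proof -
  have "F z0 = 0" using min by (intro DERIV_local_min[OF f zero_less_one]) auto
  moreover have mono: "F u < F v" if "u < v" for u v
    using that by (rule DERIV_pos_imp_increasing) (auto intro: F A)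
  ultimately have p: "0 < F (z0 + 1)" and q: "F (z0 - 1) < 0"
    using mono[of z0 "z0 + 1"] mono[of "z0 - 1" z0] by auto
  have tangent: "F u * (z - u) \<le> f z - f u" for u z
    by (rule f''_imp_f'[of UNIV]) (auto intro: f F less_imp_le[OF A])
  \<comment> \<open>Truncating at 0 makes both quotients below nonnegative, so that their sum serves
    as a bound on either side.\<close>
  define b where "b = max c 0"
  have "\<bar>z\<bar> \<le> \<bar>z0\<bar> + 1 + b / F (z0 + 1) + b / (- F (z0 - 1))" if "f z \<le> c" for z
  proof -
    have "F (z0 + 1) * (z - (z0 + 1)) \<le> b" "F (z0 - 1) * (z - (z0 - 1)) \<le> b"
      using tangent[of "z0 + 1" z] tangent[of "z0 - 1" z] nonneg[of "z0 + 1"] nonneg[of "z0 - 1"] that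
      unfolding b_def by linarith+
    then have "z - (z0 + 1) \<le> b / F (z0 + 1)" "(z0 - 1) - z \<le> b / (- F (z0 - 1))"
      using p q by (simp_all add: field_simps)
    moreover have "0 \<le> b / F (z0 + 1)" "0 \<le> b / (- F (z0 - 1))"
      using p q by (simp_all add: b_def divide_nonneg_neg)
    ultimately show ?thesis by linarith
  qed
  then show ?thesis by blast
qed

section \<open>Perturbed measurements and reduction to sign descent\<close>

text \<open>Compactness makes the set of values bounded, without which supremum and infimum over the
  reals would not bound it.\<close>

lemma continuous_bounds_on_interval:
  fixes g :: "real \<Rightarrow> real"
  assumes "continuous_on UNIV g" "\<bar>q0\<bar> \<le> b"
  shows "g (D + q0) \<le> (SUP q\<in>{-b..b}. g (D + q))" "(INF q\<in>{-b..b}. g (D + q)) \<le> g (D + q0)"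
proof -
  have "compact ((\<lambda>q. g (D + q)) ` {-b..b})"
    by (intro compact_continuous_image continuous_on_compose2[OF assms(1)] continuous_intros) auto
  then have "bounded ((\<lambda>q. g (D + q)) ` {-b..b})" by (rule compact_imp_bounded)
  then show "g (D + q0) \<le> (SUP q\<in>{-b..b}. g (D + q))" "(INF q\<in>{-b..b}. g (D + q)) \<le> g (D + q0)"
    using assms(2) by (auto intro!: cSUP_upper cINF_lower bounded_imp_bdd_above bounded_imp_bdd_below)
qed

lemma sign_preserving_pos: "sign_preserving h \<Longrightarrow> 0 \<le> t \<Longrightarrow> 0 < h t u \<Longrightarrow> 0 < u"
  unfolding sign_preserving_def by (metis less_irrefl linorder_neqE_linordered_idom not_less)

lemma sign_preserving_neg: "sign_preserving h \<Longrightarrow> 0 \<le> t \<Longrightarrow> h t u < 0 \<Longrightarrow> u < 0"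
  unfolding sign_preserving_def by (metis less_irrefl linorder_neqE_linordered_idom not_less)

theorem corollary6:
  fixes E :: "'n::finite \<Rightarrow> 'n \<Rightarrow> bool"
    and f :: "'n \<Rightarrow> 'n \<Rightarrow> real \<Rightarrow> real"
    and pbar :: "'n \<Rightarrow> 'n \<Rightarrow> real"
    and y :: "real \<Rightarrow> real ^ 'n"
  assumes "multi_agent_system E f pbar"
    and "\<And>i j. E i j \<Longrightarrow> locally_strongly_convex (f i j)"
    and "\<And>i j. E i j \<Longrightarrow> \<exists>z. \<forall>x. f i j z \<le> f i j x"
    and "\<And>i j x. E i j \<Longrightarrow> 0 \<le> f i j x"
    and "trajectory E f pbar y"
  shows "\<exists>l. (y \<longlongrightarrow> l) at_top"
proof -
  interpret multi_agent_system E f pbar by (rule assms(1))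
  have sym: "E j i" if "E i j" for i j using symmetric that by (rule sympD)
  \<comment> \<open>Extension by zero off the edges, so that energy and gradient can be summed over
    all pairs.\<close>
  define f0 where "f0 i j = (if E i j then f i j else (\<lambda>_. 0))" for i j
  define F where "F i j = (if E i j then deriv (f i j) else (\<lambda>_. 0))" for i j
  define A where "A i j = (if E i j then deriv (deriv (f i j)) else (\<lambda>_. 0))" for i j
  have f_deriv: "(f0 i j has_real_derivative F i j z) (at z)" for i j z
    using f_regular[of i j]
    by (auto simp: f0_def F_def twice_differentiable_lipschitz_def DERIV_deriv_iff_real_differentiable)
  have F_deriv: "(F i j has_real_derivative A i j z) (at z)" for i j z
    using f_regular[of i j]
    by (auto simp: F_def A_def twice_differentiable_lipschitz_def DERIV_deriv_iff_real_differentiable)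
  have A_pos: "0 < A i j z" if "E i j" for i j z
    using strongly_convex_imp_second_derivative_pos[OF f_deriv F_deriv] assms(2)[OF that] that
    by (simp add: f0_def)
  have f0_nonneg: "0 \<le> f0 i j z" for i j z using assms(4) by (simp add: f0_def)
  obtain h p where h: "\<And>i. sign_preserving (h i)"
    and p: "\<And>i j t. E i j \<Longrightarrow> 0 \<le> t \<Longrightarrow> \<bar>p i j t\<bar> \<le> pbar i j"
    and ode: "AE t in lebesgue. 0 \<le> t \<longrightarrow>
      (y has_vector_derivative (\<chi> i. h i t (control_input E f pbar (measurement p y) i t))) (at t within {0..})"
    using assms(5) unfolding trajectory_def by blast
  \<comment> \<open>The choice \<open>q = - p i j t\<close> is admissible and recovers the true
    difference from the measured one. Hence the true gradient lies between \<open>g_minus\<close>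
    and \<open>g_plus\<close>.\<close>
  have bounds: "edge_gradient F (y t) i \<le> g_plus E f pbar (measurement p y) i t"
    "g_minus E f pbar (measurement p y) i t \<le> edge_gradient F (y t) i" if t: "0 \<le> t" for t i
  proof -
    have grad: "edge_gradient F (y t) i = (\<Sum>j | E i j. - deriv (f i j) (y t $ j - y t $ i))"
      unfolding edge_gradient_def by (rule sum.mono_neutral_cong_right) (auto simp: F_def)
    have cont: "continuous_on UNIV (\<lambda>z. - deriv (f i j) z)" if "E i j" for j
    proof -
      have "isCont (deriv (f i j)) z" for z
        using DERIV_isCont[OF F_deriv[of i j z]] that by (simp add: F_def)
      then show ?thesis by (intro continuous_on_minus continuous_at_imp_continuous_on) auto
    qed
    have meas: "measurement p y i j t + - p i j t = y t $ j - y t $ i" for j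
      by (simp add: measurement_def)
    show "edge_gradient F (y t) i \<le> g_plus E f pbar (measurement p y) i t"
      unfolding grad g_plus_def
    proof (rule sum_mono)
      fix j assume "j \<in> {j. E i j}"
      then show "- deriv (f i j) (y t $ j - y t $ i)
          \<le> (SUP q\<in>{- pbar i j..pbar i j}. - deriv (f i j) (measurement p y i j t + q))"
        using continuous_bounds_on_interval(1)[OF cont, of j "- p i j t" "pbar i j" "measurement p y i j t"] p t
        unfolding meas by simp
    qed
    show "g_minus E f pbar (measurement p y) i t \<le> edge_gradient F (y t) i"
      unfolding grad g_minus_def
    proof (rule sum_mono)
      fix j assume "j \<in> {j. E i j}"
      then show "(INF q\<in>{- pbar i j..pbar i j}. - deriv (f i j) (measurement p y i j t + q))
          \<le> - deriv (f i j) (y t $ j - y t $ i)"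
        using continuous_bounds_on_interval(2)[OF cont, of j "- p i j t" "pbar i j" "measurement p y i j t"] p t
        unfolding meas by simp
    qed
  qed
  interpret sign_descent E f0 F A y
  proof
    show "E\<^sup>*\<^sup>* i j" for i j by (rule connected)
    \<comment> \<open>Local Lipschitz continuity supplies continuity of the second derivative; the 0
      instantiates the dummy time argument.\<close>
    show "continuous_on UNIV (A i j)" for i j
      using f_regular[of i j] local_lipschitz_continuous_on[of UNIV UNIV "\<lambda>_. deriv (deriv (f i j))" 0]
      by (auto simp: A_def twice_differentiable_lipschitz_def)
    show "0 \<le> A i j z" for i j z using A_pos[of i j z] by (cases "E i j") (auto simp: A_def)
    show "f0 i j z = f0 j i (- z)" for i j z
      using f_symmetric[of i j z] sym[of i j] sym[of j i] by (cases "E i j") (auto simp: f0_def)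
    show "\<exists>C. \<forall>z. f0 i j z \<le> c \<longrightarrow> \<bar>z\<bar> \<le> C" if ij: "E i j" for i j c
    proof -
      obtain z0 where "\<And>z. f0 i j z0 \<le> f0 i j z" using assms(3)[OF ij] ij by (auto simp: f0_def)
      then show ?thesis
        by (rule convex_with_minimum_coercive[OF f_deriv F_deriv A_pos[OF ij] f0_nonneg])
    qed
    show "absolutely_continuous_on {0..T} y" if "0 \<le> T" for T
      using assms(5) that unfolding trajectory_def by blast
    show "AE t in lebesgue. 0 < t \<longrightarrow> (\<exists>d. (y has_vector_derivative d) (at t) \<and>
      (\<forall>i. (0 < d $ i \<longrightarrow> edge_gradient F (y t) i < 0) \<and> (d $ i < 0 \<longrightarrow> 0 < edge_gradient F (y t) i)))"
      using ode
    proof eventually_elim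
      case (elim t)
      show ?case
      proof
        assume t: "0 < t"
        define u where "u i = control_input E f pbar (measurement p y) i t" for i
        \<comment> \<open>At positive times the one-sided derivative of the trajectory is
          two-sided.\<close>
        have "at t within {0..} = at t" using t by (intro at_within_interior) simp
        with elim t have "(y has_vector_derivative (\<chi> i. h i t (u i))) (at t)" by (simp add: u_def)
        \<comment> \<open>Upward motion requires a positive input, and the input can be positive
          only if \<open>g_plus\<close>, an upper bound for the true gradient, is negative. Downward
          motion is dual.\<close>
        moreover have "edge_gradient F (y t) i < 0" if "0 < h i t (u i)" for i
        proof -
          have "0 < u i" using sign_preserving_pos[OF h _ that] t by simp
          then have "g_plus E f pbar (measurement p y) i t < 0"
            unfolding u_def control_input_def by linarith
          with bounds(1)[of t i] t show ?thesis by linarith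
        qed
        moreover have "0 < edge_gradient F (y t) i" if "h i t (u i) < 0" for i
        proof -
          have "u i < 0" using sign_preserving_neg[OF h _ that] t by simp
          then have "0 < g_minus E f pbar (measurement p y) i t"
            unfolding u_def control_input_def by linarith
          with bounds(2)[of t i] t show ?thesis by linarith
        qed
        ultimately show "\<exists>d. (y has_vector_derivative d) (at t) \<and>
          (\<forall>i. (0 < d $ i \<longrightarrow> edge_gradient F (y t) i < 0) \<and> (d $ i < 0 \<longrightarrow> 0 < edge_gradient F (y t) i))"
          by (intro exI[of _ "\<chi> i. h i t (u i)"]) auto
      qed
    qed
  qed (use sym f_deriv F_deriv A_pos f0_nonneg in auto)
  show ?thesis by (rule converges)
qed

end
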